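(* Let $m\ge 1$ and let $\alpha_1,\ldots,\alpha_m,\beta\in\mathbb{C}$ be such that $\alpha_j,\ \beta,\ \alpha_j+\beta\in\mathbb{C}\setminus\{-1,-2,\ldots\}$ for $j=1,\ldots,m$, and $\alpha_\ell-\alpha_k\notin\mathbb{Z}$ whenever $\ell\ne k$. Then the (complex) measures $\mu^{(\alpha_j,\beta)}$, $j=1,\ldots,m$, form a perfect system. Moreover, for every multi-index $\vec n=(n_1,\ldots,n_m)$ of nonnegative integers, the corresponding formal multiple orthogonal polynomial of type II with respect to $\vec n$ is given by the Jacobi-Piñeiro polynomial $$P_{\vec n}^{(\vec\alpha,\beta)}(t)=\frac{1}{\vec n!}(1-t)^{-\beta}\prod_{j=1}^m\left(t^{-\alpha_j}\frac{d^{n_j}}{dt^{n_j}}t^{n_j+\alpha_j}\right)(1-t)^{|\vec n|+\beta}.$$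
   Context: Notation: $|\vec n|=n_1+\cdots+n_m$, $\vec n!=\prod_{j=1}^m n_j!$, $\vec\alpha=(\alpha_1,\ldots,\alpha_m)$. In the formula for $P_{\vec n}^{(\vec\alpha,\beta)}$ (Rodrigues formula), each factor $t^{-\alpha_j}\frac{d^{n_j}}{dt^{n_j}}t^{n_j+\alpha_j}$ is the operator that multiplies by $t^{n_j+\alpha_j}$, differentiates $n_j$ times, then multiplies by $t^{-\alpha_j}$; the product is a composition of operators (the order is irrelevant) applied to the function $(1-t)^{|\vec n|+\beta}$. It is read for $t\in(0,1)$ with principal powers. The measure $\mu^{(\alpha,\beta)}$ (for $\alpha,\beta,\alpha+\beta+1\in\mathbb{C}\setminus\{-1,-2,\ldots\}$) is the linear functional on polynomials $h$ defined by $$\int h(x)\,d\mu^{(\alpha,\beta)}(x)=\lim_{z\to\alpha,\,w\to\beta}(1-e^{2\pi i z})^{-1}(1-e^{2\pi i w})^{-1}\int_{\Sigma}h(t)\,t^{z}(1-t)^{w}\,dt,$$ where the limit is over non-integer $z,w$ and $\Sigma$ is a closed (Pochhammer type double loop) contour around $0$ and $1$ on the Riemann surface of $t^z(1-t)^w$, oriented so that for non-integer $z,w$ with $\Re(z),\Re(w)>-1$ the expression under the limit equals $\int_0^1h(t)t^z(1-t)^w\,dt$. Equivalently, its moments are $\int x^k\,d\mu^{(\alpha,\beta)}(x)=B(\alpha+1+k,\beta+1)$, $k=0,1,2,\ldots$, where $B(z,w)=\Gamma(z)\Gamma(w)/\Gamma(z+w)$ is the meromorphically continued beta function. For (possibly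 complex) measures $\mu_1,\ldots,\mu_m$ with finite moments and a multi-index $\vec n$, a (formal) multiple orthogonal polynomial of type II with respect to $\vec n$ is a nontrivial polynomial $p_{\vec n}$ of degree $\le|\vec n|$ with $\int p_{\vec n}(t)t^k\,d\mu_j(t)=0$ for $k=0,\ldots,n_j-1$, $j=1,\ldots,m$. The multi-index $\vec n$ is normal if every such polynomial has exact degree $|\vec n|$ (which implies uniqueness up to a multiplicative constant). The system $\mu_1,\ldots,\mu_m$ is perfect if every multi-index is normal. *)

theory Defs
  imports "HOL-Complex_Analysis.Complex_Analysis"
begin

definition negative_integers :: "complex set" where
  "negative_integers = {- of_nat k |k. k \<ge> (1::nat)}"

text \<open>
  The continuous logarithm along a path that avoids 0, starting with the principal value.
  It is unique on the interval from 0 to 1, and only its values there are used.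
\<close>

definition log_along :: "(real \<Rightarrow> complex) \<Rightarrow> real \<Rightarrow> complex" where
  "log_along g = (SOME L. continuous_on {0..1} L \<and> L 0 = Ln (g 0) \<and>
                          (\<forall>s\<in>{0..1}. exp (L s) = g s))"

text \<open>
  The integral of \<open>h(t) t^z (1 - t)^w\<close> along the lift of the path \<open>g\<close> to the Riemann surface
  of \<open>t^z (1 - t)^w\<close>: both powers are continued along \<open>g\<close>, with principal values at the
  starting point.
\<close>

definition lifted_integral ::
    "(real \<Rightarrow> complex) \<Rightarrow> (complex \<Rightarrow> complex) \<Rightarrow> complex \<Rightarrow> complex \<Rightarrow> complex" where
  "lifted_integral g h z w =
     integral {0..1} (\<lambda>s. h (g s)
       * exp (z * log_along g s) * exp (w * log_along (\<lambda>u. 1 - g u) s)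
       * vector_derivative g (at s within {0..1}))"

definition loop0 :: "real \<Rightarrow> complex" where
  "loop0 = part_circlepath 0 (1/2) 0 (2 * pi)"

definition loop1 :: "real \<Rightarrow> complex" where
  "loop1 = part_circlepath 1 (1/2) pi (3 * pi)"

text \<open>
  The double loop based at 1/2. Both loops are counterclockwise, so they multiply
  \<open>t^z (1 - t)^w\<close> by \<open>a = exp (2 \<pi> \<i> z)\<close> and \<open>b = exp (2 \<pi> \<i> w)\<close>, respectively; the commutator
  therefore lifts to a closed path. The order of the loops fixes the orientation: for real parts
  of \<open>z\<close> and \<open>w\<close> greater than -1, shrinking the loops to the segments from 1/2 to 0 and from
  1/2 to 1 turns the integral into \<open>(1 - a) (1 - b)\<close> times the integral over (0,1).
\<close>

definition pochhammer_contour :: "real \<Rightarrow> complex" where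
  "pochhammer_contour = loop1 +++ loop0 +++ reversepath loop1 +++ reversepath loop0"

definition jacobi_measure :: "complex \<Rightarrow> complex \<Rightarrow> complex poly \<Rightarrow> complex" where
  "jacobi_measure \<alpha> \<beta> h =
     Lim (at (\<alpha>, \<beta>) within {(z, w). z \<notin> \<int> \<and> w \<notin> \<int>})
       (\<lambda>(z, w). inverse (1 - exp (2 * of_real pi * \<i> * z))
               * inverse (1 - exp (2 * of_real pi * \<i> * w))
               * lifted_integral pochhammer_contour (poly h) z w)"

text \<open>
  A measure is represented by its functional on polynomials. A system of \<open>m\<close> measures and a
  multi-index are families over \<open>nat\<close> of which only the members 1, ..., \<open>m\<close> are used.
\<close>

definition index_size :: "nat \<Rightarrow> (nat \<Rightarrow> nat) \<Rightarrow> nat" where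
  "index_size m n = (\<Sum>j\<in>{1..m}. n j)"

definition type_II_mop ::
    "nat \<Rightarrow> (nat \<Rightarrow> complex poly \<Rightarrow> complex) \<Rightarrow> (nat \<Rightarrow> nat) \<Rightarrow> complex poly \<Rightarrow> bool" where
  "type_II_mop m \<mu> n p \<longleftrightarrow>
     p \<noteq> 0 \<and> degree p \<le> index_size m n \<and>
     (\<forall>j\<in>{1..m}. \<forall>k<n j. \<mu> j (p * monom 1 k) = 0)"

definition normal_index ::
    "nat \<Rightarrow> (nat \<Rightarrow> complex poly \<Rightarrow> complex) \<Rightarrow> (nat \<Rightarrow> nat) \<Rightarrow> bool" where
  "normal_index m \<mu> n \<longleftrightarrow> (\<forall>p. type_II_mop m \<mu> n p \<longrightarrow> degree p = index_size m n)"

definition perfect_system :: "nat \<Rightarrow> (nat \<Rightarrow> complex poly \<Rightarrow> complex) \<Rightarrow> bool" where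
  "perfect_system m \<mu> \<longleftrightarrow> (\<forall>n. normal_index m \<mu> n)"

text \<open>
  Functions on (0,1) are represented by total functions on the reals; derivatives at points of
  (0,1) depend only on the values on (0,1).
\<close>

definition rodrigues_op :: "complex \<Rightarrow> nat \<Rightarrow> (real \<Rightarrow> complex) \<Rightarrow> real \<Rightarrow> complex" where
  "rodrigues_op \<alpha> n f =
     (\<lambda>t. of_real t powr (- \<alpha>) *
          ((\<lambda>g x. vector_derivative g (at x)) ^^ n)
            (\<lambda>x. of_real x powr (of_nat n + \<alpha>) * f x) t)"

definition jacobi_pineiro ::
    "nat \<Rightarrow> (nat \<Rightarrow> complex) \<Rightarrow> complex \<Rightarrow> (nat \<Rightarrow> nat) \<Rightarrow> real \<Rightarrow> complex" where
  "jacobi_pineiro m \<alpha> \<beta> n t =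
     1 / (\<Prod>j\<in>{1..m}. fact (n j)) * of_real (1 - t) powr (- \<beta>) *
     foldr (\<lambda>j. rodrigues_op (\<alpha> j) (n j)) [1..<Suc m]
       (\<lambda>x. of_real (1 - x) powr (of_nat (index_size m n) + \<beta>)) t"

end

theory Submission
  imports Defs
begin

text \<open>
  The functional \<open>jacobi_measure \<alpha> \<beta>\<close> has the moments \<open>Beta (\<alpha> + 1 + k) (\<beta> + 1)\<close>
  (\<open>jacobi_measure_eq_beta_functional\<close>); once this is known, the theorem is algebra with Gamma functions.

  \<^emph>\<open>Moments.\<close> Let \<open>a\<close> and \<open>b\<close> be the monodromy factors \<open>exp (2 \<pi> \<i> z)\<close> and \<open>exp (2 \<pi> \<i> w)\<close>. The four
  arcs of the double loop are two circles, each run through once in either direction on different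
  sheets, so the contour integral is a combination of two circle integrals with coefficients
  \<open>1 - a\<close> and \<open>1 - b\<close>. For real exponents greater than -1, a primitive of the form \<open>u\<^sup>y\<^sup>+\<^sup>1 \<Phi>(u)\<close>, with
  \<open>\<Phi>\<close> holomorphic near the centre, evaluates both the circle integral and the integral over the
  radius, and shows that they differ by a factor \<open>exp (2 \<pi> \<i> y) - 1\<close>. The two radii together give
  Euler's Beta integral. Both sides of the resulting identity become entire in \<open>z\<close> and in \<open>w\<close> after
  multiplication by reciprocal Gamma functions, so the identity theorem extends it to all
  exponents, and the limit in the definition of the functional is continuity of Beta.

  \<^emph>\<open>Orthogonality.\<close> The operator \<open>t\<^sup>1\<^sup>-\<^sup>a (d/dt) t\<^sup>a\<close> maps \<open>(1 - t)\<^sup>c p\<close> to \<open>(1 - t)\<^sup>c\<^sup>-\<^sup>1 q\<close> with a polynomial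
  \<open>q\<close>, and integration by parts says that it multiplies the Mellin transform at \<open>s\<close> by \<open>a - s\<close>; the
  formal version is \<open>beta_functional_deriv_factor\<close>. The factor of the Rodrigues formula with
  index \<open>j\<close> is a composition of \<open>n j\<close> such operators, with \<open>a = \<alpha> j + 1, ..., \<alpha> j + n j\<close>. Hence the
  Mellin transform of the result vanishes where the orthogonality relations ask for it.

  \<^emph>\<open>Normality.\<close> The Mellin transform of \<open>(1 - t)\<^sup>\<beta> p\<close> is a quotient of Gamma functions times a
  polynomial in \<open>s\<close> of degree at most \<open>degree p\<close>. The orthogonality relations prescribe as many
  zeros of this polynomial as the size of the index, all distinct because the differences of the
  \<open>\<alpha> j\<close> are not integers. If \<open>degree p\<close> is smaller, the polynomial is zero, and then so is \<open>p\<close>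
  (\<open>beta_functional_unisolvent\<close>). Uniqueness up to a factor follows, since a suitable combination of
  two solutions has smaller degree.
\<close>

section \<open>The Beta moment functional\<close>

lemma shifted_notin_nonpos_Ints:
  fixes z :: complex
  assumes "z \<notin> negative_integers"
  shows "z + of_nat (Suc k) \<notin> \<int>\<^sub>\<le>\<^sub>0"
proof
  assume "z + of_nat (Suc k) \<in> \<int>\<^sub>\<le>\<^sub>0"
  then obtain l where "z + of_nat (Suc k) = - of_nat l" by (rule nonpos_Ints_cases')
  then have "z + of_nat (Suc k) + of_nat l = 0"
    by simp
  then have "z = - of_nat (Suc k + l)"
    unfolding eq_neg_iff_add_eq_0 by (simp add: add_ac)
  moreover have "Suc k + l \<ge> 1" by simp
  ultimately have "z \<in> negative_integers" unfolding negative_integers_def by blast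
  with assms show False ..
qed

lemma shifted_notin_negative_integers:
  assumes "z \<notin> negative_integers"
  shows "z + of_nat (Suc k) \<notin> negative_integers"
proof
  assume "z + of_nat (Suc k) \<in> negative_integers"
  then have "z + of_nat (Suc k) \<in> \<int>\<^sub>\<le>\<^sub>0"
    by (auto simp: negative_integers_def)
  with shifted_notin_nonpos_Ints[OF assms] show False by blast
qed

text \<open>
  Formally this is the integral of \<open>t\<^sup>s\<^sup>-\<^sup>1 (1 - t)\<^sup>c p(t)\<close> over (0,1), the Mellin transform of
  \<open>(1 - t)\<^sup>c p\<close> at \<open>s\<close>.
\<close>
definition beta_functional :: "complex \<Rightarrow> complex \<Rightarrow> complex poly \<Rightarrow> complex" where
  "beta_functional c s p = (\<Sum>k\<le>degree p. coeff p k * Beta (s + of_nat k) (c + 1))"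

lemma beta_functional_upto:
  assumes "degree p \<le> N"
  shows "beta_functional c s p = (\<Sum>k\<le>N. coeff p k * Beta (s + of_nat k) (c + 1))"
  unfolding beta_functional_def
  by (rule sum.mono_neutral_left) (use assms in \<open>auto simp: coeff_eq_0\<close>)

lemma beta_functional_0 [simp]: "beta_functional c s 0 = 0"
  by (simp add: beta_functional_def)

lemma beta_functional_add:
  "beta_functional c s (p + q) = beta_functional c s p + beta_functional c s q"
  by (simp add: beta_functional_upto[of _ "max (degree p) (degree q)"] degree_add_le
      sum.distrib ring_distribs)

lemma beta_functional_smult: "beta_functional c s (smult e p) = e * beta_functional c s p"
  by (simp add: beta_functional_upto[of _ "degree p"] degree_smult_le sum_distrib_left mult_ac)

lemma beta_functional_pCons:
  "beta_functional c s (pCons e p) = e * Beta s (c + 1) + beta_functional c (s + 1) p"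
proof -
  have "beta_functional c s (pCons e p) =
    (\<Sum>k\<le>Suc (degree p). coeff (pCons e p) k * Beta (s + of_nat k) (c + 1))"
    by (rule beta_functional_upto) (simp add: degree_pCons_le)
  also have "\<dots> = e * Beta s (c + 1) + beta_functional c (s + 1) p"
    by (subst sum.atMost_Suc_shift) (simp add: beta_functional_def add_ac)
  finally show ?thesis .
qed

lemma beta_functional_monom_mult:
  "beta_functional c s (p * monom 1 k) = beta_functional c (s + of_nat k) p"
proof (induction k arbitrary: s)
  case (Suc k)
  have "p * monom 1 (Suc k) = pCons 0 (p * monom 1 k)"
    by (simp add: monom_Suc)
  then show ?case
    by (simp add: beta_functional_pCons Suc.IH add_ac)
qed (simp add: monom_0)

section \<open>The lift of the double loop\<close>

text \<open>
  The circle of radius 1/2 around the origin, together with the logarithm along it that starts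
  with the principal value. Both loops of the contour are this circle, up to \<open>t \<mapsto> 1 - t\<close>.
\<close>
definition circ :: "real \<Rightarrow> complex" where
  "circ s = exp (2 * of_real pi * \<i> * of_real s) / 2"

definition circ_log :: "real \<Rightarrow> complex" where
  "circ_log s = of_real (ln (1/2)) + 2 * of_real pi * \<i> * of_real s"

lemma exp_circ_log: "exp (circ_log s) = circ s"
proof -
  have "exp (of_real (ln (1/2))) = (1/2 :: complex)"
    unfolding exp_of_real by simp
  then show ?thesis by (simp add: circ_def circ_log_def exp_add)
qed

lemma norm_circ [simp]: "norm (circ s) = 1/2"
  by (simp add: circ_def norm_divide)

lemma circ_ends [simp]: "circ 0 = 1/2" "circ 1 = 1/2"
  by (auto simp: circ_def)

lemma continuous_on_circ [continuous_intros]: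
  "continuous_on S f \<Longrightarrow> continuous_on S (\<lambda>s. circ (f s))"
  "continuous_on S f \<Longrightarrow> continuous_on S (\<lambda>s. circ_log (f s))"
  by (auto simp: circ_def circ_log_def intro!: continuous_intros)

lemma circ_has_vector_derivative:
  "(circ has_vector_derivative 2 * of_real pi * \<i> * circ s) (at s within S)"
  unfolding circ_def
  by (rule has_vector_derivative_real_field derivative_eq_intros refl | simp)+

lemma Re_one_minus_circ: "Re (1 - circ s) > 0"
  using complex_Re_le_cmod[of "circ s"] by simp

lemma one_minus_circ_notin [simp]: "1 - circ s \<notin> \<real>\<^sub>\<le>\<^sub>0" "circ s \<noteq> 1"
  using Re_one_minus_circ[of s] by (auto simp: complex_nonpos_Reals_iff)

lemma loop0_eq: "loop0 = circ"
  by (rule ext) (simp add: loop0_def circ_def part_circlepath_def linepath_def mult_ac)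

lemma loop1_eq: "loop1 = (\<lambda>s. 1 - circ s)"
proof
  fix s
  have "exp (\<i> * of_real (linepath pi (3 * pi) s)) = exp (\<i> * pi + 2 * of_real pi * \<i> * of_real s)"
    by (simp add: linepath_def algebra_simps)
  then show "loop1 s = 1 - circ s"
    by (simp add: loop1_def circ_def part_circlepath_def exp_add)
qed

lemma pochhammer_contour_eq:
  "pochhammer_contour = (\<lambda>s. 1 - circ s) +++ circ +++ (\<lambda>s. 1 - circ (1 - s)) +++ (\<lambda>s. circ (1 - s))"
  by (simp add: pochhammer_contour_def loop0_eq loop1_eq reversepath_def)

text \<open>
  A lift of a path along the covering \<open>exp\<close> is determined by its initial value.
\<close>
lemma log_along_eqI:
  assumes "path L" "L 0 = Ln (g 0)" "\<And>s. s \<in> {0..1} \<Longrightarrow> exp (L s) = g s" "s \<in> {0..1}"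
  shows "log_along g s = L s"
proof -
  let ?P = "\<lambda>L. continuous_on {0..1} L \<and> L 0 = Ln (g 0) \<and> (\<forall>s\<in>{0..1}. exp (L s) = g s)"
  have P: "?P (log_along g)"
    unfolding log_along_def by (rule someI[of ?P L]) (use assms in \<open>auto simp: path_def\<close>)
  have cg: "continuous_on {0..1} g"
    by (rule continuous_on_eq[of _ "\<lambda>s. exp (L s)"])
       (use assms in \<open>auto simp: path_def intro!: continuous_intros\<close>)
  have nz: "g s \<noteq> 0" if "s \<in> {0..1}" for s
    using assms(3)[OF that] exp_not_eq_zero[of "L s"] by metis
  show ?thesis
    by (rule covering_space_lift_unique[OF covering_space_exp_punctured_plane, 
          where T = "{0..1}" and f = g and a = 0])
       (use P assms cg nz in \<open>auto simp: path_def\<close>)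
qed

text \<open>
  A concatenation runs through each of its halves at double speed. Separating the integrand from
  the derivative of the path in this and the next lemma allows integrands that depend on the
  position on the path, and not only on the point, as the branches of the powers do.
\<close>
lemma has_integral_joinpaths:
  fixes e1 e2 :: "real \<Rightarrow> complex"
  assumes "(e1 has_integral i1) {0..1}" "(e2 has_integral i2) {0..1}"
  shows "((\<lambda>s. 2 * (e1 +++ e2) s) has_integral i1 + i2) {0..1}"
proof (rule has_integral_combine[where c = "1/2"])
  have "((\<lambda>s. 2 * e1 (2 * s)) has_integral i1) {0..1/2}"
    using has_integral_affinity01[OF assms(1), where m = 2 and c = 0, THEN has_integral_cmul[where c = 2]]
    by (simp_all only: image_affinity_atLeastAtMost_div_diff, simp_all add: scaleR_conv_of_real)
  then show "((\<lambda>s. 2 * (e1 +++ e2) s) has_integral i1) {0..1/2}"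
    by (rule has_integral_spike_finite[of "{}", rotated 2]) (auto simp: joinpaths_def)
  have "((\<lambda>s. 2 * e2 (2 * s - 1)) has_integral i2) {1/2..1}"
    using has_integral_affinity01[OF assms(2), where m = 2 and c = "-1", THEN has_integral_cmul[where c = 2]]
    by (simp_all only: image_affinity_atLeastAtMost_div_diff, simp_all add: scaleR_conv_of_real)
  then show "((\<lambda>s. 2 * (e1 +++ e2) s) has_integral i2) {1/2..1}"
    by (rule has_integral_spike_finite[of "{1/2}", rotated 2]) (auto simp: joinpaths_def)
qed auto

text \<open>
  The exceptional sets collect the corners of the path, which accumulate when concatenations are
  nested.
\<close>
lemma joinpaths_has_vector_derivative:
  fixes g1 g2 d1 d2 :: "real \<Rightarrow> complex"
  assumes "\<exists>S. finite S \<and> (\<forall>s\<in>{0<..<1} - S. (g1 has_vector_derivative d1 s) (at s))"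
      and "\<exists>S. finite S \<and> (\<forall>s\<in>{0<..<1} - S. (g2 has_vector_derivative d2 s) (at s))"
  shows "\<exists>S. finite S \<and> (\<forall>s\<in>{0<..<1} - S. ((g1 +++ g2) has_vector_derivative 2 * (d1 +++ d2) s) (at s))"
proof -
  obtain S1 where S1: "finite S1" 
    "\<And>s. s \<in> {0<..<1} - S1 \<Longrightarrow> (g1 has_vector_derivative d1 s) (at s)"
    using assms(1) by blast
  obtain S2 where S2: "finite S2"
    "\<And>s. s \<in> {0<..<1} - S2 \<Longrightarrow> (g2 has_vector_derivative d2 s) (at s)"
    using assms(2) by blast
  define S where "S = insert (1/2) ((\<lambda>x. x / 2) ` S1 \<union> (\<lambda>x. (x + 1) / 2) ` S2)"
  have "((g1 +++ g2) has_vector_derivative 2 * (d1 +++ d2) s) (at s)" 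
    if s: "s \<in> {0<..<1} - S" for s
  proof (cases "s < 1/2")
    case True
    have "2 * s \<notin> S1"
    proof
      assume "2 * s \<in> S1"
      then have "(2 * s) / 2 \<in> (\<lambda>x. x / 2) ` S1" by blast
      with s show False by (simp add: S_def)
    qed
    then have g1: "(g1 has_vector_derivative d1 (2 * s)) (at (2 * s))"
      using S1(2)[of "2 * s"] True s by auto
    have "((\<lambda>x. 2 * x) has_vector_derivative 2) (at s)"
      by (auto intro!: derivative_eq_intros)
    from vector_diff_chain_at[OF this g1]
    have "((\<lambda>x. g1 (2 * x)) has_vector_derivative 2 * d1 (2 * s)) (at s)"
      by (simp add: o_def scaleR_conv_of_real)
    then have "((g1 +++ g2) has_vector_derivative 2 * d1 (2 * s)) (at s)"
      by (rule has_vector_derivative_transform_within_open[of _ _ _ "{..<1/2}"])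
         (use True in \<open>auto simp: joinpaths_def\<close>)
    with True show ?thesis by (simp add: joinpaths_def)
  next
    case False
    with s have s': "s > 1/2" by (auto simp: S_def)
    have "2 * s - 1 \<notin> S2"
    proof
      assume "2 * s - 1 \<in> S2"
      then have "(2 * s - 1 + 1) / 2 \<in> (\<lambda>x. (x + 1) / 2) ` S2" by blast
      with s show False by (simp add: S_def)
    qed
    then have g2: "(g2 has_vector_derivative d2 (2 * s - 1)) (at (2 * s - 1))"
      using S2(2)[of "2 * s - 1"] s' s by auto
    have "((\<lambda>x. 2 * x - 1) has_vector_derivative 2) (at s)"
      by (auto intro!: derivative_eq_intros)
    from vector_diff_chain_at[OF this g2]
    have "((\<lambda>x. g2 (2 * x - 1)) has_vector_derivative 2 * d2 (2 * s - 1)) (at s)"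
      by (simp add: o_def scaleR_conv_of_real)
    then have "((g1 +++ g2) has_vector_derivative 2 * d2 (2 * s - 1)) (at s)"
      by (rule has_vector_derivative_transform_within_open[of _ _ _ "{1/2<..}"])
         (use s' in \<open>auto simp: joinpaths_def\<close>)
    with s' show ?thesis by (simp add: joinpaths_def)
  qed
  moreover have "finite S"
    using S1(1) S2(1) by (simp add: S_def)
  ultimately show ?thesis by blast
qed

text \<open>
  The two logarithms continued along the double loop. A circle around 0 leaves the principal
  logarithm of \<open>1 - t\<close> unchanged and adds \<open>2 \<pi> \<i>\<close> to the logarithm of \<open>t\<close>, and conversely around 1; each
  commutator factor is later undone by its inverse.
\<close>
definition log_t :: "real \<Rightarrow> complex" where
  "log_t = (\<lambda>s. Ln (1 - circ s)) +++ circ_log +++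
           (\<lambda>s. Ln (1 - circ (1 - s)) + 2 * of_real pi * \<i>) +++ (\<lambda>s. circ_log (1 - s))"

definition log_1mt :: "real \<Rightarrow> complex" where
  "log_1mt = circ_log +++ (\<lambda>s. Ln (1 - circ s) + 2 * of_real pi * \<i>) +++
             (\<lambda>s. circ_log (1 - s)) +++ (\<lambda>s. Ln (1 - circ (1 - s)))"

lemma Ln_half: "Ln (1/2) = of_real (ln (1/2))"
  using Ln_of_real[of "1/2"] by simp

lemma log_along_pochhammer_contour:
  assumes "s \<in> {0..1}"
  shows "log_along pochhammer_contour s = log_t s"
proof (rule log_along_eqI[OF _ _ _ assms])
  show "path log_t"
    unfolding log_t_def
    by (intro path_join_imp)
       (auto simp: path_def pathstart_def pathfinish_def joinpaths_def circ_log_def Ln_half 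
             intro!: continuous_intros)
  show "log_t 0 = Ln (pochhammer_contour 0)"
    by (simp add: log_t_def pochhammer_contour_eq joinpaths_def)
  show "exp (log_t s) = pochhammer_contour s" if "s \<in> {0..1}" for s
    by (simp add: log_t_def pochhammer_contour_eq joinpaths_def exp_circ_log exp_add)
qed

lemma log_along_one_minus_pochhammer_contour:
  assumes "s \<in> {0..1}"
  shows "log_along (\<lambda>u. 1 - pochhammer_contour u) s = log_1mt s"
proof (rule log_along_eqI[OF _ _ _ assms])
  show "path log_1mt"
    unfolding log_1mt_def
    by (intro path_join_imp)
       (auto simp: path_def pathstart_def pathfinish_def joinpaths_def circ_log_def Ln_half 
             intro!: continuous_intros)
  show "log_1mt 0 = Ln (1 - pochhammer_contour 0)"
    by (simp add: log_1mt_def pochhammer_contour_eq joinpaths_def circ_log_def Ln_half)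
  show "exp (log_1mt s) = 1 - pochhammer_contour s" if "s \<in> {0..1}" for s
    by (simp add: log_1mt_def pochhammer_contour_eq joinpaths_def exp_circ_log exp_add)
qed

definition loop_integral :: "(complex \<Rightarrow> complex) \<Rightarrow> complex \<Rightarrow> complex \<Rightarrow> complex" where
  "loop_integral h z w = integral {0..1} (\<lambda>s. h (circ s) * exp (z * circ_log s) *
     exp (w * Ln (1 - circ s)) * (2 * of_real pi * \<i> * circ s))"

lemma loop_integral_has_integral:
  assumes "continuous_on UNIV h"
  shows "((\<lambda>s. h (circ s) * exp (z * circ_log s) *
     exp (w * Ln (1 - circ s)) * (2 * of_real pi * \<i> * circ s)) has_integral loop_integral h z w) {0..1}"
  unfolding loop_integral_def
  by (intro integrable_integral integrable_continuous_interval continuous_intros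
        continuous_on_compose2[OF assms]) auto

text \<open>
  Each circle is run through twice, in opposite directions and on sheets whose values differ by
  the monodromy of the other circle. This leaves the factors \<open>1 - exp (2 \<pi> \<i> z)\<close> and
  \<open>1 - exp (2 \<pi> \<i> w)\<close>. The circle around 1 appears after the substitution \<open>t \<mapsto> 1 - t\<close>, which exchanges
  the exponents.
\<close>
lemma lifted_integral_pochhammer_contour:
  assumes h: "continuous_on UNIV h"
  shows "lifted_integral pochhammer_contour h z w =
     - (1 - exp (2 * of_real pi * \<i> * z)) * loop_integral (\<lambda>u. h (1 - u)) w z
     - (1 - exp (2 * of_real pi * \<i> * w)) * loop_integral h z w"
proof -
  define a where "a = exp (2 * of_real pi * \<i> * z)"
  define b where "b = exp (2 * of_real pi * \<i> * w)"
  define d1 where "d1 s = 2 * of_real pi * \<i> * circ s" for s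
  define e0 where "e0 s = h (circ s) * exp (z * circ_log s) * exp (w * Ln (1 - circ s)) * d1 s" for s
  define e1 where "e1 s = h (1 - circ s) * exp (w * circ_log s) * exp (z * Ln (1 - circ s)) * d1 s" for s
  have i0: "(e0 has_integral loop_integral h z w) {0..1}"
    unfolding e0_def d1_def by (rule loop_integral_has_integral[OF h])
  have i1: "(e1 has_integral loop_integral (\<lambda>u. h (1 - u)) w z) {0..1}"
    unfolding e1_def d1_def
    by (rule loop_integral_has_integral) (intro continuous_on_compose2[OF h] continuous_intros, auto)
  have rev: "((\<lambda>s. e (1 - s)) has_integral i) {0..1}" if "(e has_integral i) {0..1}" 
    for e :: "real \<Rightarrow> complex" and i
    using has_integral_affinity01[OF that, where m = "-1" and c = 1] by simp
  \<comment> \<open>The derivative of the contour and the integrand, arc by arc; \<open>a\<close> and \<open>b\<close> are the factors that the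
      powers have picked up on the second and third arc.\<close>
  define D where "D = (\<lambda>s. 2 * ((\<lambda>s. - d1 s) +++ (\<lambda>s. 2 * (d1 +++ (\<lambda>s. 2 * ((\<lambda>s. d1 (1 - s)) +++ (\<lambda>s. - d1 (1 - s))) s)) s)) s)"
  define E where "E = (\<lambda>s. 2 * ((\<lambda>s. - e1 s) +++ (\<lambda>s. 2 * ((\<lambda>s. b * e0 s) +++ 
       (\<lambda>s. 2 * ((\<lambda>s. a * e1 (1 - s)) +++ (\<lambda>s. - e0 (1 - s))) s)) s)) s)"
  have der: "(circ has_vector_derivative d1 s) (at s)" for s
    unfolding d1_def by (rule circ_has_vector_derivative)
  have der': "((\<lambda>s. circ (1 - s)) has_vector_derivative - d1 (1 - s)) (at s)" for s
  proof -
    have "((\<lambda>x. 1 - x) has_vector_derivative -1) (at s)"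
      by (auto intro!: derivative_eq_intros)
    from vector_diff_chain_at[OF this der] show ?thesis by (simp add: o_def)
  qed
  obtain S where S: "finite S" 
    "\<And>s. s \<in> {0<..<1} - S \<Longrightarrow> (pochhammer_contour has_vector_derivative D s) (at s)"
  proof -
    have 1: "((\<lambda>s. 1 - circ s) has_vector_derivative - d1 s) (at s)" for s
      using has_vector_derivative_diff[OF has_vector_derivative_const der] by simp
    have 2: "((\<lambda>s. 1 - circ (1 - s)) has_vector_derivative d1 (1 - s)) (at s)" for s
      using has_vector_derivative_diff[OF has_vector_derivative_const der'] by simp
    have "\<exists>S. finite S \<and> (\<forall>s\<in>{0<..<1} - S. (pochhammer_contour has_vector_derivative D s) (at s))"
      unfolding pochhammer_contour_eq D_def
      by (intro joinpaths_has_vector_derivative exI[of _ "{}"]) (use 1 2 der der' in auto)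
    then show ?thesis using that by blast
  qed
  have E_int: "(E has_integral - loop_integral (\<lambda>u. h (1 - u)) w z + (b * loop_integral h z w + 
        (a * loop_integral (\<lambda>u. h (1 - u)) w z + - loop_integral h z w))) {0..1}"
    unfolding E_def
    by (intro has_integral_joinpaths has_integral_neg has_integral_mult_right i0 i1 rev[of "\<lambda>s. a * e1 s"] rev[of "\<lambda>s. - e0 s"])
  have E_eq: "h (pochhammer_contour s) * exp (z * log_along pochhammer_contour s) *
       exp (w * log_along (\<lambda>u. 1 - pochhammer_contour u) s) *
       vector_derivative pochhammer_contour (at s within {0..1}) = E s"
    if "s \<in> {0..1} - (insert 0 (insert 1 S))" for s
  proof -
    have "vector_derivative pochhammer_contour (at s within {0..1}) = D s"
      using S(2)[of s] that
      by (intro vector_derivative_at_within_ivl) auto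
    moreover have ez: "exp (z * (l + 2 * of_real pi * \<i>)) = a * exp (z * l)" 
      and ew: "exp (w * (l + 2 * of_real pi * \<i>)) = b * exp (w * l)" for l
      by (simp_all add: a_def b_def ring_distribs exp_add mult_ac)
    have "h (pochhammer_contour s) * exp (z * log_t s) * exp (w * log_1mt s) * D s = E s"
    proof (cases "s \<le> 1/2")
      case True
      then show ?thesis
        by (simp add: pochhammer_contour_eq log_t_def log_1mt_def D_def E_def joinpaths_def e1_def)
    next
      case 1: False
      show ?thesis
      proof (cases "2 * s - 1 \<le> 1/2")
        case True
        with 1 show ?thesis
          by (simp add: pochhammer_contour_eq log_t_def log_1mt_def D_def E_def joinpaths_def e0_def ew)
      next
        case 2: False
        show ?thesis
        proof (cases "2 * (2 * s - 1) - 1 \<le> 1/2")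
          case True
          with 1 2 show ?thesis
            by (simp add: pochhammer_contour_eq log_t_def log_1mt_def D_def E_def joinpaths_def e1_def ez)
        next
          case False
          with 1 2 show ?thesis
            by (simp add: pochhammer_contour_eq log_t_def log_1mt_def D_def E_def joinpaths_def e0_def)
        qed
      qed
    qed
    ultimately show ?thesis
      using that by (simp add: log_along_pochhammer_contour log_along_one_minus_pochhammer_contour)
  qed
  have "((\<lambda>s. h (pochhammer_contour s) * exp (z * log_along pochhammer_contour s) *
       exp (w * log_along (\<lambda>u. 1 - pochhammer_contour u) s) *
       vector_derivative pochhammer_contour (at s within {0..1})) has_integral 
       - loop_integral (\<lambda>u. h (1 - u)) w z + (b * loop_integral h z w + 
        (a * loop_integral (\<lambda>u. h (1 - u)) w z + - loop_integral h z w))) {0..1}"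
    by (rule has_integral_spike_finite[where S = "insert 0 (insert 1 S)", OF _ E_eq E_int]) (use S(1) in auto)
  then have "lifted_integral pochhammer_contour h z w =
      - loop_integral (\<lambda>u. h (1 - u)) w z + (b * loop_integral h z w + 
        (a * loop_integral (\<lambda>u. h (1 - u)) w z + - loop_integral h z w))"
    unfolding lifted_integral_def by (rule integral_unique)
  then show ?thesis
    unfolding a_def[symmetric] b_def[symmetric] by (simp add: algebra_simps)
qed

section \<open>Circle integrals and the Beta integral\<close>

text \<open>
  The equation says that \<open>u\<^sup>y\<^sup>+\<^sup>1 \<Phi>(u)\<close> is a primitive of \<open>u\<^sup>y \<phi>(u)\<close>. Coefficientwise it divides the
  Taylor coefficient of order \<open>n\<close> by \<open>n + y + 1\<close>, which only improves convergence.
\<close>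
lemma power_primitive:
  fixes y :: real
  assumes hol: "\<phi> holomorphic_on ball 0 1" and y: "y > -1"
  obtains \<Phi> \<Phi>' where 
    "\<And>u. u \<in> ball 0 1 \<Longrightarrow> (\<Phi> has_field_derivative \<Phi>' u) (at u)"
    "\<And>u. u \<in> ball 0 1 \<Longrightarrow> u * \<Phi>' u + (of_real y + 1) * \<Phi> u = \<phi> u"
proof -
  define c where "c n = (deriv ^^ n) \<phi> 0 / fact n" for n
  define d where "d n = c n / (of_nat n + of_real y + 1)" for n
  define \<Phi> where "\<Phi> u = (\<Sum>n. d n * u ^ n)" for u
  define \<Phi>' where "\<Phi>' u = (\<Sum>n. diffs d n * u ^ n)" for u
  have nz: "of_nat n + of_real y + 1 \<noteq> (0::complex)" for n
  proof
    assume "of_nat n + of_real y + 1 = (0::complex)"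
    then have "complex_of_real (real n + y + 1) = of_real 0" by simp
    then show False using y unfolding of_real_eq_iff by linarith
  qed
  have sums: "(\<lambda>n. c n * u ^ n) sums \<phi> u" if "norm u < 1" for u
    using holomorphic_power_series[OF hol, of u] that by (simp add: c_def)
  have summable: "summable (\<lambda>n. d n * u ^ n)" if u: "norm u < 1" for u
  proof (rule summable_comparison_test')
    \<comment> \<open>Convergence at a point of larger modulus gives absolute convergence at \<open>u\<close>.\<close>
    obtain r where r: "norm u < r" "r < 1" using dense[OF u] by blast
    have "summable (\<lambda>n. norm (c n * u ^ n))"
      by (rule powser_insidea[of _ "of_real r"]) (use r sums[of "of_real r"] norm_ge_zero[of u] in \<open>auto simp: sums_iff\<close>)
    then show "summable (\<lambda>n. norm (c n * u ^ n) / (y + 1))"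
      by (rule summable_divide)
    show "norm (d n * u ^ n) \<le> norm (c n * u ^ n) / (y + 1)" for n
    proof -
      have "y + 1 \<le> real n + y + 1" by simp
      also have "\<dots> = norm (complex_of_real (real n + y + 1))" using y by (simp only: norm_of_real)
      finally have "y + 1 \<le> norm (of_nat n + of_real y + 1 :: complex)" by simp
      then have "norm (c n * u ^ n) / norm (of_nat n + of_real y + 1 :: complex) \<le> norm (c n * u ^ n) / (y + 1)"
        using y by (intro divide_left_mono mult_pos_pos) auto
      then show ?thesis by (simp add: d_def norm_mult norm_divide)
    qed
  qed
  show thesis
  proof
    fix u :: complex assume "u \<in> ball 0 1"
    then have u: "norm u < 1" by simp
    show "(\<Phi> has_field_derivative \<Phi>' u) (at u)"
      unfolding \<Phi>_def \<Phi>'_def by (rule termdiffs_strong'[of 1]) (use summable u in auto)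
    have "summable (\<lambda>n. diffs d n * u ^ n)"
      by (rule termdiff_converges[OF u]) (use summable in auto)
    then have "(\<lambda>n. of_nat n * d n * u ^ (n - Suc 0)) sums \<Phi>' u"
      unfolding \<Phi>'_def by (rule diffs_equiv)
    then have "(\<lambda>n. u * (of_nat n * d n * u ^ (n - Suc 0)) + (of_real y + 1) * (d n * u ^ n))
       sums (u * \<Phi>' u + (of_real y + 1) * \<Phi> u)"
      unfolding \<Phi>_def by (intro sums_add sums_mult summable_sums summable u)
    moreover have "u * (of_nat n * d n * u ^ (n - Suc 0)) + (of_real y + 1) * (d n * u ^ n) = c n * u ^ n" for n
    proof -
      have "c n = (of_nat n + of_real y + 1) * d n"
        using nz[of n] by (simp add: d_def)
      then show ?thesis by (cases n) (simp_all add: algebra_simps)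
    qed
    ultimately show "u * \<Phi>' u + (of_real y + 1) * \<Phi> u = \<phi> u"
      using sums[OF u] by (simp add: sums_iff)
  qed
qed

text \<open>
  This replaces shrinking the circle to the radius: the primitive \<open>u\<^sup>y\<^sup>+\<^sup>1 \<Phi>(u)\<close> gains a factor
  \<open>exp (2 \<pi> \<i> y)\<close> along the circle, and it vanishes at 0, so both integrals are multiples of its value
  at 1/2.
\<close>
lemma circle_integral_power:
  fixes y :: real
  assumes hol: "\<phi> holomorphic_on ball 0 1" and y: "y > -1"
  obtains X where
    "((\<lambda>s. exp (of_real y * circ_log s) * \<phi> (circ s) * (2 * of_real pi * \<i> * circ s)) has_integral
       (exp (2 * of_real pi * \<i> * of_real y) - 1) * X) {0..1}"
    "((\<lambda>t. of_real (t powr y) * \<phi> (of_real t)) has_integral X) {0..1/2}"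
proof -
  obtain \<Phi> \<Phi>' where der: "\<And>u. u \<in> ball 0 1 \<Longrightarrow> (\<Phi> has_field_derivative \<Phi>' u) (at u)"
    and eq: "\<And>u. u \<in> ball 0 1 \<Longrightarrow> u * \<Phi>' u + (of_real y + 1) * \<Phi> u = \<phi> u"
    using power_primitive[OF assms] by metis
  define X where "X = of_real ((1/2) powr (y + 1)) * \<Phi> (1/2)"
  define G where "G s = exp ((of_real y + 1) * circ_log s) * \<Phi> (circ s)" for s
  show thesis
  proof
    have "((\<lambda>s. exp (of_real y * circ_log s) * \<phi> (circ s) * (2 * of_real pi * \<i> * circ s)) 
       has_integral (G 1 - G 0)) {0..1}"
    proof (rule fundamental_theorem_of_calculus)
      fix s :: real
      have circ_ball: "circ s \<in> ball 0 1" by simp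
      have 1: "((\<lambda>z. exp ((of_real y + 1) * (of_real (ln (1/2)) + 2 * of_real pi * \<i> * z)))
          has_field_derivative exp ((of_real y + 1) * circ_log s) * ((of_real y + 1) * (2 * of_real pi * \<i>)))
          (at (of_real s))"
        unfolding circ_log_def by (auto intro!: derivative_eq_intros)
      have 2: "((\<Phi> \<circ> circ) has_vector_derivative (2 * of_real pi * \<i> * circ s) * \<Phi>' (circ s)) (at s within {0..1})"
        by (rule field_vector_diff_chain_within[OF circ_has_vector_derivative
             has_field_derivative_at_within[OF der[OF circ_ball]]])
      have "(G has_vector_derivative exp ((of_real y + 1) * circ_log s) * ((2 * of_real pi * \<i> * circ s) * \<Phi>' (circ s)) 
          + (exp ((of_real y + 1) * circ_log s) * ((of_real y + 1) * (2 * of_real pi * \<i>))) * \<Phi> (circ s)) 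
          (at s within {0..1})"
        unfolding G_def using has_vector_derivative_mult[OF has_vector_derivative_real_field[OF 1] 2]
        by (simp add: circ_log_def o_def)
      also have "exp ((of_real y + 1) * circ_log s) * ((2 * of_real pi * \<i> * circ s) * \<Phi>' (circ s)) 
          + (exp ((of_real y + 1) * circ_log s) * ((of_real y + 1) * (2 * of_real pi * \<i>))) * \<Phi> (circ s) =
          exp ((of_real y + 1) * circ_log s) * (2 * of_real pi * \<i>) * 
          (circ s * \<Phi>' (circ s) + (of_real y + 1) * \<Phi> (circ s))"
        by (simp add: algebra_simps)
      also have "\<dots> = exp (of_real y * circ_log s) * \<phi> (circ s) * (2 * of_real pi * \<i> * circ s)"
        unfolding eq[OF circ_ball] by (simp add: ring_distribs exp_add exp_circ_log mult_ac)
      finally show "(G has_vector_derivative exp (of_real y * circ_log s) * \<phi> (circ s) * 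
          (2 * of_real pi * \<i> * circ s)) (at s within {0..1})" .
    qed simp
    also have "G 1 - G 0 = (exp (2 * of_real pi * \<i> * of_real y) - 1) * X"
    proof -
      have "exp ((of_real y + 1) * circ_log 0) = of_real ((1/2) powr (y + 1))"
        by (simp add: circ_log_def powr_def mult_ac flip: exp_of_real)
      moreover have "exp ((of_real y + 1) * circ_log 1) = 
         exp ((of_real y + 1) * circ_log 0) * exp (2 * of_real pi * \<i> * of_real y)"
        by (simp add: circ_log_def ring_distribs exp_add mult_ac)
      ultimately show ?thesis by (simp add: G_def X_def algebra_simps)
    qed
    finally show "((\<lambda>s. exp (of_real y * circ_log s) * \<phi> (circ s) * (2 * of_real pi * \<i> * circ s)) has_integral
       (exp (2 * of_real pi * \<i> * of_real y) - 1) * X) {0..1}" .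
  next
    define H where "H t = of_real (t powr (y + 1)) * \<Phi> (of_real t)" for t :: real
    have "((\<lambda>t. of_real (t powr y) * \<phi> (of_real t)) has_integral (H (1/2) - H 0)) {0..1/2}"
    proof (rule fundamental_theorem_of_calculus_interior)
      have "continuous_on (ball 0 1) \<Phi>"
        using der by (intro holomorphic_on_imp_continuous_on holomorphic_onI) 
           (auto simp: field_differentiable_def intro: has_field_derivative_at_within)
      then show "continuous_on {0..1/2} H"
        unfolding H_def using y
        by (auto intro!: continuous_intros continuous_on_powr' intro: continuous_on_compose2)
      fix t :: real assume t: "t \<in> {0<..<1/2}"
      have t_ball: "complex_of_real t \<in> ball 0 1" using t by simp
      have "((\<lambda>t. t powr (y + 1)) has_real_derivative (y + 1) * t powr y) (at t)"
        using t by (auto intro!: derivative_eq_intros)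
      then have 1: "((\<lambda>t. of_real (t powr (y + 1))) has_vector_derivative complex_of_real ((y + 1) * t powr y)) (at t)"
        unfolding has_real_derivative_iff_has_vector_derivative
        by (rule bounded_linear.has_vector_derivative[OF bounded_linear_of_real])
      have 2: "((\<lambda>t. \<Phi> (of_real t)) has_vector_derivative \<Phi>' (of_real t)) (at t)"
        by (rule has_vector_derivative_real_field[OF der[OF t_ball]])
      have "(H has_vector_derivative of_real (t powr (y + 1)) * \<Phi>' (of_real t) + 
          of_real ((y + 1) * t powr y) * \<Phi> (of_real t)) (at t)"
        unfolding H_def by (rule has_vector_derivative_mult[OF 1 2])
      also have "of_real (t powr (y + 1)) * \<Phi>' (of_real t) + of_real ((y + 1) * t powr y) * \<Phi> (of_real t)
         = of_real (t powr y) * (of_real t * \<Phi>' (of_real t) + (of_real y + 1) * \<Phi> (of_real t))"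
        using t by (simp add: powr_add algebra_simps)
      also have "\<dots> = of_real (t powr y) * \<phi> (of_real t)"
        unfolding eq[OF t_ball] ..
      finally show "(H has_vector_derivative of_real (t powr y) * \<phi> (of_real t)) (at t)" .
    qed simp
    also have "H (1/2) - H 0 = X"
      using y by (simp add: H_def X_def)
    finally show "((\<lambda>t. of_real (t powr y) * \<phi> (of_real t)) has_integral X) {0..1/2}" .
  qed
qed

lemma loop_integral_real:
  fixes x y :: real
  assumes "x > -1"
  shows "\<exists>X. ((\<lambda>t. t powr x * (1 - t) powr y) has_integral X) {0..1/2} \<and>
     loop_integral (\<lambda>_. 1) x y = (exp (2 * of_real pi * \<i> * of_real x) - 1) * of_real X"
proof -
  define \<phi> where "\<phi> u = exp (of_real y * Ln (1 - u))" for u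
  have "\<phi> holomorphic_on ball 0 1"
    unfolding \<phi>_def
  proof (intro holomorphic_intros)
    fix u :: complex assume "u \<in> ball 0 1"
    then have "Re u < 1" using complex_Re_le_cmod[of u] by simp
    then show "1 - u \<notin> \<real>\<^sub>\<le>\<^sub>0" by (simp add: complex_nonpos_Reals_iff)
  qed
  from circle_integral_power[OF this assms] obtain X where X:
    "((\<lambda>s. exp (of_real x * circ_log s) * \<phi> (circ s) * (2 * of_real pi * \<i> * circ s)) has_integral
       (exp (2 * of_real pi * \<i> * of_real x) - 1) * X) {0..1}"
    "((\<lambda>t. of_real (t powr x) * \<phi> (of_real t)) has_integral X) {0..1/2}" .
  have "((\<lambda>t. complex_of_real (t powr x * (1 - t) powr y)) has_integral X) {0..1/2}"
  proof (rule has_integral_eq[OF _ X(2)])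
    fix t :: real assume t: "t \<in> {0..1/2}"
    then have "Ln (1 - complex_of_real t) = of_real (ln (1 - t))"
      using Ln_of_real[of "1 - t"] by simp
    then show "of_real (t powr x) * \<phi> (of_real t) = of_real (t powr x * (1 - t) powr y)"
      using t by (simp add: \<phi>_def powr_def exp_of_real[symmetric])
  qed
  from has_integral_Re[OF this] has_integral_Im[OF this]
  have Re: "((\<lambda>t. t powr x * (1 - t) powr y) has_integral Re X) {0..1/2}" 
    and Im: "((\<lambda>_::real. 0::real) has_integral Im X) {0..1/2}"
    by (simp_all only: Re_complex_of_real Im_complex_of_real)
  have "Im X = 0" by (rule has_integral_unique[OF Im has_integral_0])
  then have "X = of_real (Re X)" by (simp add: complex_eq_iff)
  moreover have "loop_integral (\<lambda>_. 1) x y = (exp (2 * of_real pi * \<i> * of_real x) - 1) * X"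
    unfolding loop_integral_def integral_unique[OF X(1), symmetric] \<phi>_def by simp
  ultimately show ?thesis using Re by (intro exI[of _ "Re X"]) simp
qed

text \<open>
  The two circle integrals contribute the Beta integral over (0,1/2) and over (1/2,1),
  respectively.
\<close>
lemma lifted_integral_1_real:
  fixes x y :: real
  assumes "x > -1" "y > -1"
  shows "lifted_integral pochhammer_contour (\<lambda>_. 1) x y =
    (1 - exp (2 * of_real pi * \<i> * of_real x)) * (1 - exp (2 * of_real pi * \<i> * of_real y)) * 
    of_real (Beta (x + 1) (y + 1))"
proof -
  obtain X where X: "((\<lambda>t. t powr x * (1 - t) powr y) has_integral X) {0..1/2}"
     "loop_integral (\<lambda>_. 1) x y = (exp (2 * of_real pi * \<i> * of_real x) - 1) * of_real X"
    using loop_integral_real[OF assms(1)] by blast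
  obtain Y where Y: "((\<lambda>t. t powr y * (1 - t) powr x) has_integral Y) {0..1/2}"
     "loop_integral (\<lambda>_. 1) y x = (exp (2 * of_real pi * \<i> * of_real y) - 1) * of_real Y"
    using loop_integral_real[OF assms(2)] by blast
  have "((\<lambda>t. t powr x * (1 - t) powr y) has_integral Y) {1/2..1}"
    using has_integral_affinity[OF Y(1)[folded cbox_interval], of "-1" 1] 
    by (simp add: mult_ac image_affinity_atLeastAtMost_diff)
  with X(1) have "((\<lambda>t. t powr x * (1 - t) powr y) has_integral (X + Y)) {0..1}"
    by (intro has_integral_combine[of 0 "1/2" 1]) auto
  moreover have "((\<lambda>t. t powr x * (1 - t) powr y) has_integral Beta (x + 1) (y + 1)) {0..1}"
    using has_integral_Beta_real[of "x + 1" "y + 1"] assms by simp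
  ultimately have "Beta (x + 1) (y + 1) = X + Y"
    by (rule has_integral_unique[symmetric])
  have rearrange: "- (1 - a) * ((b - 1) * of_real Y) - (1 - b) * ((a - 1) * of_real X) = 
     (1 - a) * (1 - b) * of_real (X + Y)" for a b :: complex
    by (simp add: algebra_simps)
  show ?thesis
    unfolding lifted_integral_pochhammer_contour[OF continuous_on_const] X(2) Y(2) 
      \<open>Beta (x + 1) (y + 1) = X + Y\<close> by (rule rearrange)
qed

lemma loop_integral_1_entire:
  "(\<lambda>z. loop_integral (\<lambda>_. 1) z w) holomorphic_on UNIV"
  "(\<lambda>w. loop_integral (\<lambda>_. 1) z w) holomorphic_on UNIV"
proof -
  have "(\<lambda>z. integral (cbox 0 1) (\<lambda>s. 1 * exp (z * circ_log s) * exp (w * Ln (1 - circ s)) * 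
      (2 * of_real pi * \<i> * circ s))) holomorphic_on UNIV"
  proof (rule leibniz_rule_holomorphic)
    show "((\<lambda>z. 1 * exp (z * circ_log s) * exp (w * Ln (1 - circ s)) * (2 * of_real pi * \<i> * circ s))
        has_field_derivative circ_log s * exp (z * circ_log s) * exp (w * Ln (1 - circ s)) * 
      (2 * of_real pi * \<i> * circ s)) (at z within UNIV)" for z s
      by (auto intro!: derivative_eq_intros)
  qed (auto simp: case_prod_unfold intro!: integrable_continuous_interval continuous_intros)
  then show "(\<lambda>z. loop_integral (\<lambda>_. 1) z w) holomorphic_on UNIV"
    by (simp add: loop_integral_def)
  have "(\<lambda>w. integral (cbox 0 1) (\<lambda>s. 1 * exp (z * circ_log s) * exp (w * Ln (1 - circ s)) * 
      (2 * of_real pi * \<i> * circ s))) holomorphic_on UNIV"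
  proof (rule leibniz_rule_holomorphic)
    show "((\<lambda>w. 1 * exp (z * circ_log s) * exp (w * Ln (1 - circ s)) * (2 * of_real pi * \<i> * circ s))
        has_field_derivative exp (z * circ_log s) * (Ln (1 - circ s) * exp (w * Ln (1 - circ s))) * 
      (2 * of_real pi * \<i> * circ s)) (at w within UNIV)" for w s
      by (auto intro!: derivative_eq_intros)
  qed (auto simp: case_prod_unfold intro!: integrable_continuous_interval continuous_intros)
  then show "(\<lambda>w. loop_integral (\<lambda>_. 1) z w) holomorphic_on UNIV"
    by (simp add: loop_integral_def)
qed

text \<open>
  The form of the identity theorem that carries the Beta integral from real to complex exponents.
\<close>
lemma entire_zero_on_positive_reals:
  assumes "f holomorphic_on UNIV" "\<And>x::real. x > 0 \<Longrightarrow> f (of_real x) = 0"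
  shows "f z = 0"
proof (rule analytic_continuation[where f = f and w = z and S = UNIV and U = "complex_of_real ` {0<..}" and \<xi> = 1])
  show "(1::complex) islimpt of_real ` {0<..}"
    unfolding islimpt_approachable
  proof (intro allI impI)
    fix e :: real assume "e > 0"
    then show "\<exists>x'\<in>complex_of_real ` {0<..}. x' \<noteq> 1 \<and> dist x' 1 < e"
      by (intro bexI[of _ "of_real (1 + e / 2)"] imageI) (auto simp: dist_norm)
  qed
qed (use assms in auto)

text \<open>
  Moving the Gamma functions of the numerator to the other side makes both sides entire in each
  variable, so that no poles have to be avoided in the continuation from positive real exponents.
\<close>
lemma lifted_integral_1:
  "lifted_integral pochhammer_contour (\<lambda>_. 1) z w * (rGamma (z + 1) * rGamma (w + 1)) =
   (1 - exp (2 * of_real pi * \<i> * z)) * (1 - exp (2 * of_real pi * \<i> * w)) * rGamma (z + w + 2)"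
proof -
  define D where "D z w = lifted_integral pochhammer_contour (\<lambda>_. 1) z w * (rGamma (z + 1) * rGamma (w + 1)) -
     (1 - exp (2 * of_real pi * \<i> * z)) * (1 - exp (2 * of_real pi * \<i> * w)) * rGamma (z + w + 2)" for z w
  have hol: "(\<lambda>z. D z w) holomorphic_on UNIV" "(\<lambda>w. D z w) holomorphic_on UNIV" for z w
    unfolding D_def lifted_integral_pochhammer_contour[OF continuous_on_const]
    by (intro holomorphic_intros loop_integral_1_entire)+
  have "D (of_real x) (of_real y) = 0" if "x > 0" "y > 0" for x y :: real
  proof -
    have "complex_of_real (Beta (x + 1) (y + 1)) * (rGamma (of_real x + 1) * rGamma (of_real y + 1)) =
      of_real (Beta (x + 1) (y + 1) * (rGamma (x + 1) * rGamma (y + 1)))"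
      by (simp flip: rGamma_complex_of_real)
    also have "Beta (x + 1) (y + 1) * (rGamma (x + 1) * rGamma (y + 1)) = rGamma (x + y + 2)"
    proof -
      have "Gamma (x + 1) \<noteq> 0" "Gamma (y + 1) \<noteq> 0"
        using Gamma_real_pos[of "x + 1"] Gamma_real_pos[of "y + 1"] that by linarith+
      then have "Gamma (x + 1) * rGamma (x + 1) = 1" "Gamma (y + 1) * rGamma (y + 1) = 1"
        by (simp_all add: rGamma_inverse_Gamma)
      moreover have "Beta (x + 1) (y + 1) * (rGamma (x + 1) * rGamma (y + 1)) = 
         (Gamma (x + 1) * rGamma (x + 1)) * (Gamma (y + 1) * rGamma (y + 1)) * rGamma (x + y + 2)"
        by (simp add: Beta_altdef add_ac mult_ac)
      ultimately show ?thesis by simp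
    qed
    also have "complex_of_real \<dots> = rGamma (of_real x + of_real y + 2)"
      by (simp flip: rGamma_complex_of_real)
    finally show ?thesis
      using that by (simp add: D_def lifted_integral_1_real mult.assoc)
  qed
  then have "D z (of_real y) = 0" if "y > 0" for y
    using entire_zero_on_positive_reals[OF hol(1)[of "of_real y"]] that by blast
  then have "D z w = 0"
    using entire_zero_on_positive_reals[OF hol(2)[of z]] by blast
  then show ?thesis by (simp add: D_def)
qed

lemma exp_2pi_i_eq_1_iff: "exp (2 * of_real pi * \<i> * z) = 1 \<longleftrightarrow> z \<in> \<int>"
proof -
  have "exp (2 * of_real pi * \<i> * z) = 1 \<longleftrightarrow> (\<exists>n::int. 2 * of_real pi * \<i> * z = 2 * of_real pi * \<i> * of_int n)"
    unfolding exp_eq_1 by (auto simp: complex_eq_iff)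
  also have "\<dots> \<longleftrightarrow> z \<in> \<int>" by (auto simp: Ints_def)
  finally show ?thesis .
qed

text \<open>
  A power of the variable shifts an exponent, since it is the exponential of a multiple of the
  same branch of the logarithm.
\<close>
lemma loop_integral_power:
  "loop_integral (\<lambda>u. u ^ k) z w = loop_integral (\<lambda>_. 1) (z + of_nat k) w"
  "loop_integral (\<lambda>u. (1 - u) ^ k) w z = loop_integral (\<lambda>_. 1) w (z + of_nat k)"
proof -
  have 1: "circ s ^ k = exp (of_nat k * circ_log s)" 
    and 2: "(1 - circ s) ^ k = exp (of_nat k * Ln (1 - circ s))" for s
    by (simp_all add: exp_of_nat_mult exp_circ_log)
  show "loop_integral (\<lambda>u. u ^ k) z w = loop_integral (\<lambda>_. 1) (z + of_nat k) w"
       "loop_integral (\<lambda>u. (1 - u) ^ k) w z = loop_integral (\<lambda>_. 1) w (z + of_nat k)"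
    unfolding loop_integral_def 1 2 by (simp_all add: ring_distribs exp_add mult_ac)
qed

lemma lifted_integral_power:
  assumes "z \<notin> \<int>" "w \<notin> \<int>"
  shows "lifted_integral pochhammer_contour (\<lambda>u. u ^ k) z w =
   (1 - exp (2 * of_real pi * \<i> * z)) * (1 - exp (2 * of_real pi * \<i> * w)) * Beta (z + 1 + of_nat k) (w + 1)"
proof -
  let ?z = "z + of_nat k"
  have nint: "?z + 1 \<notin> \<int>\<^sub>\<le>\<^sub>0" "w + 1 \<notin> \<int>\<^sub>\<le>\<^sub>0"
    using assms nonpos_Ints_subset_Ints Ints_diff[of "?z + 1" "of_nat (Suc k)"] Ints_diff[of "w + 1" 1] 
    by auto
  have per: "exp (2 * of_real pi * \<i> * ?z) = exp (2 * of_real pi * \<i> * z)"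
    using exp_2pi_i_eq_1_iff[of "of_nat k"] by (simp add: ring_distribs exp_add)
  have "lifted_integral pochhammer_contour (\<lambda>u. u ^ k) z w = 
        lifted_integral pochhammer_contour (\<lambda>_. 1) ?z w"
    by (simp add: lifted_integral_pochhammer_contour continuous_intros loop_integral_power per)
  moreover have "lifted_integral pochhammer_contour (\<lambda>_. 1) ?z w =
     (1 - exp (2 * of_real pi * \<i> * z)) * (1 - exp (2 * of_real pi * \<i> * w)) * Beta (?z + 1) (w + 1)"
  proof -
    have "Beta (?z + 1) (w + 1) = rGamma (?z + w + 2) / (rGamma (?z + 1) * rGamma (w + 1))"
      by (simp add: Beta_altdef Gamma_def field_simps)
    moreover have "rGamma (?z + 1) * rGamma (w + 1) \<noteq> 0"
      using nint by (simp add: rGamma_eq_zero_iff)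
    ultimately show ?thesis
      using lifted_integral_1[of ?z w, unfolded per] by (metis nonzero_mult_div_cancel_right times_divide_eq_right)
  qed
  ultimately show ?thesis by (simp add: add_ac)
qed

lemma loop_integral_sum:
  assumes "\<And>k. k \<in> A \<Longrightarrow> continuous_on UNIV (h k)" "finite A"
  shows "loop_integral (\<lambda>u. \<Sum>k\<in>A. c k * h k u) z w = (\<Sum>k\<in>A. c k * loop_integral (h k) z w)"
proof -
  have "((\<lambda>s. \<Sum>k\<in>A. c k * (h k (circ s) * exp (z * circ_log s) *
     exp (w * Ln (1 - circ s)) * (2 * of_real pi * \<i> * circ s))) has_integral (\<Sum>k\<in>A. c k * loop_integral (h k) z w)) {0..1}"
    by (intro has_integral_sum has_integral_mult_right loop_integral_has_integral assms)
  then have "((\<lambda>s. (\<Sum>k\<in>A. c k * h k (circ s)) * exp (z * circ_log s) *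
     exp (w * Ln (1 - circ s)) * (2 * of_real pi * \<i> * circ s)) has_integral (\<Sum>k\<in>A. c k * loop_integral (h k) z w)) {0..1}"
    by (rule has_integral_eq[rotated]) (simp add: sum_distrib_right mult.assoc)
  then show ?thesis
    unfolding loop_integral_def[of "\<lambda>u. \<Sum>k\<in>A. c k * h k u"] by (rule integral_unique)
qed

lemma lifted_integral_poly:
  assumes "z \<notin> \<int>" "w \<notin> \<int>"
  shows "lifted_integral pochhammer_contour (poly p) z w =
   (1 - exp (2 * of_real pi * \<i> * z)) * (1 - exp (2 * of_real pi * \<i> * w)) * beta_functional w (z + 1) p"
proof -
  have p: "poly p u = (\<Sum>k\<le>degree p. coeff p k * u ^ k)" for u
    by (rule poly_altdef)
  have 1: "loop_integral (poly p) z w = (\<Sum>k\<le>degree p. coeff p k * loop_integral (\<lambda>u. u ^ k) z w)"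
    unfolding p[abs_def] by (rule loop_integral_sum) (auto intro!: continuous_intros)
  have 2: "loop_integral (\<lambda>u. poly p (1 - u)) w z = 
     (\<Sum>k\<le>degree p. coeff p k * loop_integral (\<lambda>u. (1 - u) ^ k) w z)"
    unfolding p by (rule loop_integral_sum) (auto intro!: continuous_intros)
  have "lifted_integral pochhammer_contour (poly p) z w =
      (\<Sum>k\<le>degree p. coeff p k * lifted_integral pochhammer_contour (\<lambda>u. u ^ k) z w)"
    by (simp add: lifted_integral_pochhammer_contour continuous_intros 1 2 sum_distrib_left
         sum_subtractf[symmetric] algebra_simps)
  also have "\<dots> = (1 - exp (2 * of_real pi * \<i> * z)) * (1 - exp (2 * of_real pi * \<i> * w)) * 
      beta_functional w (z + 1) p"
    by (simp add: lifted_integral_power[OF assms] beta_functional_def sum_distrib_left mult_ac)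
  finally show ?thesis .
qed

text \<open>
  The limit that defines the functional is unique because a small imaginary shift of both
  exponents makes them non-integer.
\<close>
lemma nonint_pairs_not_trivial: 
  fixes \<alpha> \<beta> :: complex
  shows "at (\<alpha>, \<beta>) within {(z, w). z \<notin> \<int> \<and> w \<notin> \<int>} \<noteq> bot"
  unfolding trivial_limit_within islimpt_approachable not_not
proof (intro allI impI)
  fix e :: real assume "e > 0"
  then have "infinite ({0<..<e/2} - {- Im \<alpha>, - Im \<beta>})"
    by (intro Diff_infinite_finite infinite_Ioo) auto
  then have "{0<..<e/2} - {- Im \<alpha>, - Im \<beta>} \<noteq> {}" by (rule infinite_imp_nonempty)
  then obtain d where "d \<in> {0<..<e/2} - {- Im \<alpha>, - Im \<beta>}" by blast
  then have d: "0 < d" "d < e/2" "d \<noteq> - Im \<alpha>" "d \<noteq> - Im \<beta>"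
    by simp_all
  have nint: "z + \<i> * of_real d \<notin> \<int>" if "d \<noteq> - Im z" for z
    using that by (auto elim!: Ints_cases simp: complex_eq_iff)
  have "dist (\<alpha> + \<i> * of_real d, \<beta> + \<i> * of_real d) (\<alpha>, \<beta>) \<le> d + d"
    unfolding dist_Pair_Pair using d(1) 
    by (intro order.trans[OF sqrt_sum_squares_le_sum]) (auto simp: dist_norm norm_mult)
  then show "\<exists>x'\<in>{(z, w). z \<notin> \<int> \<and> w \<notin> \<int>}. x' \<noteq> (\<alpha>, \<beta>) \<and> dist x' (\<alpha>, \<beta>) < e"
    using d nint by (intro bexI[of _ "(\<alpha> + \<i> * of_real d, \<beta> + \<i> * of_real d)"]) auto
qed

text \<open>
  For non-integer exponents the expression under the limit is already given by Beta values, which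
  depend continuously on the exponents as long as the Gamma functions of the numerator have no
  poles.
\<close>
theorem jacobi_measure_eq_beta_functional:
  assumes "\<alpha> \<notin> negative_integers" "\<beta> \<notin> negative_integers"
  shows "jacobi_measure \<alpha> \<beta> h = beta_functional \<beta> (\<alpha> + 1) h"
  unfolding jacobi_measure_def
proof (rule tendsto_Lim[OF nonint_pairs_not_trivial])
  let ?F = "at (\<alpha>, \<beta>) within {(z, w). z \<notin> \<int> \<and> w \<notin> \<int>}"
  have fst: "(fst \<longlongrightarrow> \<alpha>) ?F" and snd: "(snd \<longlongrightarrow> \<beta>) ?F"
    using tendsto_fst[OF tendsto_ident_at] tendsto_snd[OF tendsto_ident_at] by fastforce+
  have "((\<lambda>x. Beta (fst x + 1 + of_nat k) (snd x + 1)) \<longlongrightarrow> Beta (\<alpha> + 1 + of_nat k) (\<beta> + 1)) ?F" for k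
    unfolding Beta_altdef
    by (intro tendsto_mult tendsto_Gamma isCont_tendsto_compose[OF isCont_rGamma[OF continuous_ident]] 
         tendsto_add tendsto_const fst snd)
       (use shifted_notin_nonpos_Ints[OF assms(1), of k] shifted_notin_nonpos_Ints[OF assms(2), of 0] 
         in \<open>simp_all add: add_ac\<close>)
  then have lim: "((\<lambda>x. beta_functional (snd x) (fst x + 1) h) \<longlongrightarrow> beta_functional \<beta> (\<alpha> + 1) h) ?F"
    unfolding beta_functional_def by (intro tendsto_sum tendsto_mult tendsto_const)
  have ev: "\<forall>\<^sub>F x in ?F. beta_functional (snd x) (fst x + 1) h =
     (case x of (z, w) \<Rightarrow> inverse (1 - exp (2 * of_real pi * \<i> * z))
               * inverse (1 - exp (2 * of_real pi * \<i> * w))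
               * lifted_integral pochhammer_contour (poly h) z w)"
    unfolding eventually_at_filter
  proof (rule always_eventually, clarify)
    fix z w :: complex assume zw: "z \<notin> \<int>" "w \<notin> \<int>"
    have cancel: "inverse A * inverse B * (A * B * M) = M" if "A \<noteq> 0" "B \<noteq> 0" for A B M :: complex
      using that by (simp add: field_simps)
    show "beta_functional (snd (z, w)) (fst (z, w) + 1) h =
        inverse (1 - exp (2 * of_real pi * \<i> * z)) * inverse (1 - exp (2 * of_real pi * \<i> * w))
               * lifted_integral pochhammer_contour (poly h) z w"
      unfolding lifted_integral_poly[OF zw]
      by (subst cancel) (use zw exp_2pi_i_eq_1_iff[of z] exp_2pi_i_eq_1_iff[of w] in auto)
  qed
  show "((\<lambda>(z, w). inverse (1 - exp (2 * of_real pi * \<i> * z))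
               * inverse (1 - exp (2 * of_real pi * \<i> * w))
               * lifted_integral pochhammer_contour (poly h) z w) \<longlongrightarrow> beta_functional \<beta> (\<alpha> + 1) h) ?F"
    by (rule Lim_transform_eventually[OF lim ev])
qed

section \<open>The Rodrigues formula\<close>

text \<open>
  The derivative of \<open>t\<^sup>a (1 - t)\<^sup>c p\<close> is \<open>t\<^sup>a\<^sup>-\<^sup>1 (1 - t)\<^sup>c\<^sup>-\<^sup>1\<close> times this polynomial.
\<close>
definition deriv_factor :: "complex \<Rightarrow> complex \<Rightarrow> complex poly \<Rightarrow> complex poly" where
  "deriv_factor a c p = [:a, - (a + c):] * p + [:0, 1, - 1:] * pderiv p"

text \<open>
  Multiplication of \<open>p\<close> by \<open>t\<close> amounts to raising \<open>a\<close> by one.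
\<close>
lemma deriv_factor_pCons:
  "deriv_factor a c (pCons e p) = smult e [:a, - (a + c):] + pCons 0 (deriv_factor (a + 1) c p)"
  unfolding poly_eq_poly_eq_iff[symmetric]
  by (rule ext) (simp add: deriv_factor_def pderiv_pCons algebra_simps)

lemma degree_deriv_factor: "degree (deriv_factor a c p) \<le> Suc (degree p)"
proof -
  have 1: "degree ([:a, - (a + c):] * p) \<le> Suc (degree p)"
    using degree_mult_le[of "[:a, - (a + c):]" p] by (auto simp: degree_pCons_eq_if split: if_splits)
  have "degree ([:0, 1, - 1:] * pderiv p) \<le> Suc (degree p)" 
  proof (cases "pderiv p = 0")
    case False
    then have "degree p > 0" by (metis pderiv_eq_0_iff gr0I)
    then show ?thesis
      using degree_mult_le[of "[:0, 1, - 1:]" "pderiv p"] by (simp add: degree_pderiv)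
  qed simp
  with 1 show ?thesis unfolding deriv_factor_def by (rule degree_add_le)
qed

lemma poly_0_deriv_factor: "poly (deriv_factor a c p) 0 = a * poly p 0"
  by (simp add: deriv_factor_def)

text \<open>
  Integration by parts for \<open>t\<^sup>s\<^sup>-\<^sup>1 t\<^sup>1\<^sup>-\<^sup>a (d/dt) (t\<^sup>a (1 - t)\<^sup>c p)\<close>, as an identity between Beta values. By
  the shift \<open>a + 1\<close>, \<open>s + 1\<close> the induction over the coefficients reduces to a constant \<open>p\<close>, where it is
  the recurrence of the Gamma function.
\<close>
lemma beta_functional_deriv_factor:
  assumes "s \<notin> \<int>\<^sub>\<le>\<^sub>0" "c \<notin> \<int>\<^sub>\<le>\<^sub>0"
  shows "beta_functional (c - 1) s (deriv_factor a c p) = (a - s) * beta_functional c s p"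
  using assms(1)
proof (induction p arbitrary: a s)
  case 0
  then show ?case by (simp add: deriv_factor_def)
next
  case (pCons e p)
  have s: "s \<noteq> 0" and c: "c \<noteq> 0" using pCons.prems assms(2) by auto
  have "s + 1 \<notin> \<int>\<^sub>\<le>\<^sub>0" using pCons.prems by (metis plus_one_in_nonpos_Ints_imp)
  from pCons.IH[OF this] have IH: "beta_functional (c - 1) (s + 1) (deriv_factor (a + 1) c p) =
      (a - s) * beta_functional c (s + 1) p" by simp
  define G where "G = Gamma s * Gamma c * rGamma (s + c + 1)"
  have "Beta s c = (s + c) * G"
    unfolding G_def Beta_altdef using rGamma_plus1[of "s + c"] by simp
  moreover have "Beta (s + 1) c = s * G"
    unfolding G_def Beta_altdef using Gamma_plus1[OF pCons.prems] by (simp add: add_ac)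
  moreover have "Beta s (c + 1) = c * G"
    unfolding G_def Beta_altdef using Gamma_plus1[OF assms(2)] by (simp add: add_ac)
  ultimately have "a * Beta s c - (a + c) * Beta (s + 1) c = (a - s) * Beta s (c + 1)"
    by (simp add: algebra_simps)
  note Beta_step = this
  have "beta_functional (c - 1) s (deriv_factor a c (pCons e p)) =
      e * (a * Beta s c - (a + c) * Beta (s + 1) c) + (a - s) * beta_functional c (s + 1) p"
    by (simp add: deriv_factor_pCons beta_functional_add beta_functional_smult
        beta_functional_pCons IH) (simp add: algebra_simps)
  then show ?case
    unfolding Beta_step by (simp add: beta_functional_pCons algebra_simps)
qed

text \<open>
  Differentiating repeatedly lowers both exponents by one in each step.
\<close>
fun deriv_factor_iter :: "complex \<Rightarrow> complex \<Rightarrow> nat \<Rightarrow> complex poly \<Rightarrow> complex poly" where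
  "deriv_factor_iter a c 0 p = p"
| "deriv_factor_iter a c (Suc i) p = 
     deriv_factor (a - of_nat i) (c - of_nat i) (deriv_factor_iter a c i p)"

lemma degree_deriv_factor_iter: "degree (deriv_factor_iter a c i p) \<le> degree p + i"
proof (induction i)
  case (Suc i)
  show ?case
    using degree_deriv_factor[of "a - of_nat i" "c - of_nat i" "deriv_factor_iter a c i p"] Suc
    by simp
qed simp

lemma poly_0_deriv_factor_iter:
  "poly (deriv_factor_iter a c i p) 0 = (\<Prod>l<i. a - of_nat l) * poly p 0"
  by (induction i) (simp_all add: poly_0_deriv_factor)

lemma beta_functional_deriv_factor_iter:
  assumes "s \<notin> \<int>\<^sub>\<le>\<^sub>0" "\<And>l. l < i \<Longrightarrow> c - of_nat l \<notin> \<int>\<^sub>\<le>\<^sub>0"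
  shows "beta_functional (c - of_nat i) s (deriv_factor_iter a c i p) =
         (\<Prod>l<i. a - of_nat l - s) * beta_functional c s p"
  using assms(2)
proof (induction i)
  case (Suc i)
  have "beta_functional (c - of_nat i - 1) s (deriv_factor_iter a c (Suc i) p) =
     (a - of_nat i - s) * beta_functional (c - of_nat i) s (deriv_factor_iter a c i p)"
    using beta_functional_deriv_factor[OF assms(1) Suc.prems[of i]] by simp
  then show ?case using Suc by (simp add: diff_diff_eq add_ac)
qed simp

lemma weighted_poly_has_vector_derivative:
  fixes x :: real
  assumes "x \<in> {0<..<1}"
  shows "((\<lambda>x. of_real x powr a * (of_real (1 - x) powr c * poly p (of_real x))) has_vector_derivative
     of_real x powr (a - 1) * (of_real (1 - x) powr (c - 1) * poly (deriv_factor a c p) (of_real x))) (at x)"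
proof -
  let ?x = "complex_of_real x"
  have nr: "?x \<notin> \<real>\<^sub>\<le>\<^sub>0" "1 - ?x \<notin> \<real>\<^sub>\<le>\<^sub>0"
    using assms by (auto simp: complex_nonpos_Reals_iff)
  have nz: "?x \<noteq> 0" "1 - ?x \<noteq> 0" using nr by auto
  have px: "?x powr a = ?x powr (a - 1) * ?x" "(1 - ?x) powr c = (1 - ?x) powr (c - 1) * (1 - ?x)"
    using nz by (simp_all add: powr_diff)
  have "((\<lambda>z. z powr a * ((1 - z) powr c * poly p z)) has_field_derivative
     (a * ?x powr (a - 1)) * ((1 - ?x) powr c * poly p ?x) + 
     ?x powr a * (- (c * (1 - ?x) powr (c - 1)) * poly p ?x + (1 - ?x) powr c * poly (pderiv p) ?x))
     (at ?x)"
    using nr nz by (auto intro!: derivative_eq_intros simp: algebra_simps)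
  also have "(a * ?x powr (a - 1)) * ((1 - ?x) powr c * poly p ?x) + 
     ?x powr a * (- (c * (1 - ?x) powr (c - 1)) * poly p ?x + (1 - ?x) powr c * poly (pderiv p) ?x)
     = ?x powr (a - 1) * ((1 - ?x) powr (c - 1) * poly (deriv_factor a c p) ?x)"
    unfolding px by (simp add: deriv_factor_def algebra_simps)
  finally show ?thesis
    using has_vector_derivative_real_field by fastforce
qed

lemma iterated_derivative_weighted_poly:
  assumes "t \<in> {0<..<1}"
    and f: "\<And>x. x \<in> {0<..<1} \<Longrightarrow> f x = of_real x powr a * (of_real (1 - x) powr c * poly p (of_real x))"
  shows "((\<lambda>g x. vector_derivative g (at x)) ^^ i) f t =
     of_real t powr (a - of_nat i) * (of_real (1 - t) powr (c - of_nat i) * 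
       poly (deriv_factor_iter a c i p) (of_real t))"
  using assms(1)
proof (induction i arbitrary: t)
  case (Suc i)
  let ?D = "((\<lambda>g x. vector_derivative g (at x)) ^^ i) f"
  have "(?D has_vector_derivative of_real t powr (a - of_nat i - 1) * 
      (of_real (1 - t) powr (c - of_nat i - 1) * poly (deriv_factor_iter a c (Suc i) p) (of_real t))) (at t)"
    unfolding deriv_factor_iter.simps
    by (rule has_vector_derivative_transform_within_open
         [OF weighted_poly_has_vector_derivative[OF Suc.prems] open_greaterThanLessThan])
       (use Suc in auto)
  then show ?case
    by (simp add: vector_derivative_at diff_diff_eq add_ac)
qed (use f in simp)

lemma rodrigues_op_weighted_poly:
  assumes "t \<in> {0<..<1}"
    and "\<And>x. x \<in> {0<..<1} \<Longrightarrow> f x = of_real (1 - x) powr c * poly p (of_real x)"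
  shows "rodrigues_op \<alpha> n f t = of_real (1 - t) powr (c - of_nat n) *
     poly (deriv_factor_iter (of_nat n + \<alpha>) c n p) (of_real t)"
proof -
  have "rodrigues_op \<alpha> n f t = of_real t powr (- \<alpha>) * (of_real t powr (of_nat n + \<alpha> - of_nat n) *
     (of_real (1 - t) powr (c - of_nat n) * 
       poly (deriv_factor_iter (of_nat n + \<alpha>) c n p) (of_real t)))"
    unfolding rodrigues_op_def
    by (subst iterated_derivative_weighted_poly[OF assms(1)]) (use assms(2) in auto)
  also have "of_real t powr (- \<alpha>) * of_real t powr (of_nat n + \<alpha> - of_nat n) = (1::complex)"
    using assms(1) by (simp flip: powr_add)
  ultimately show ?thesis by (metis mult.assoc mult_1)
qed

text \<open>
  Each operator keeps the form \<open>(1 - t)\<^sup>c p\<close> and multiplies the Mellin transform by linear factors, so the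
  zeros produced by one operator survive the others. Non-vanishing at 0 is the simplest way to see
  that the polynomial is not zero: the value there is a product of the numbers \<open>\<alpha> j + i\<close> with
  \<open>i \<ge> 1\<close>.
\<close>
lemma rodrigues_product_weighted_poly:
  assumes "\<And>l. l < (\<Sum>j\<leftarrow>js. n j) \<Longrightarrow> c - of_nat l \<notin> \<int>\<^sub>\<le>\<^sub>0"
    and "\<And>j. j \<in> set js \<Longrightarrow> \<alpha> j \<notin> negative_integers"
  shows "\<exists>p. (\<forall>t\<in>{0<..<1}. foldr (\<lambda>j. rodrigues_op (\<alpha> j) (n j)) js (\<lambda>x. of_real (1 - x) powr c) t =
               of_real (1 - t) powr (c - of_nat (\<Sum>j\<leftarrow>js. n j)) * poly p (of_real t)) \<and>
           degree p \<le> (\<Sum>j\<leftarrow>js. n j) \<and> poly p 0 \<noteq> 0 \<and>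
           (\<forall>j\<in>set js. \<forall>k<n j. beta_functional (c - of_nat (\<Sum>j\<leftarrow>js. n j)) (\<alpha> j + 1 + of_nat k) p = 0)"
  using assms
proof (induction js)
  case Nil
  show ?case by (intro exI[of _ 1]) auto
next
  case (Cons j js)
  define N where "N = (\<Sum>j\<leftarrow>js. n j)"
  define f where "f = foldr (\<lambda>j. rodrigues_op (\<alpha> j) (n j)) js (\<lambda>x. of_real (1 - x) powr c)"
  have N: "(\<Sum>j\<leftarrow>j # js. n j) = n j + N" by (simp add: N_def)
  have "\<exists>p. (\<forall>t\<in>{0<..<1}. f t = of_real (1 - t) powr (c - of_nat N) * poly p (of_real t)) \<and>
           degree p \<le> N \<and> poly p 0 \<noteq> 0 \<and>
           (\<forall>j\<in>set js. \<forall>k<n j. beta_functional (c - of_nat N) (\<alpha> j + 1 + of_nat k) p = 0)"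
    unfolding f_def N_def by (rule Cons.IH) (use Cons.prems N in auto)
  then obtain p where
    f: "\<And>t. t \<in> {0<..<1} \<Longrightarrow> f t = of_real (1 - t) powr (c - of_nat N) * poly p (of_real t)" and
    deg: "degree p \<le> N" and p0: "poly p 0 \<noteq> 0" and
    orth: "\<And>i k. i \<in> set js \<Longrightarrow> k < n i \<Longrightarrow> 
       beta_functional (c - of_nat N) (\<alpha> i + 1 + of_nat k) p = 0"
    by blast
  define q where "q = deriv_factor_iter (of_nat (n j) + \<alpha> j) (c - of_nat N) (n j) p"
  have cN: "c - of_nat N - of_nat l = c - of_nat (l + N)" for l
    by simp
  have beta_q: "beta_functional (c - of_nat (n j + N)) s q =
     (\<Prod>l<n j. of_nat (n j) + \<alpha> j - of_nat l - s) * beta_functional (c - of_nat N) s p"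
    if "s \<notin> \<int>\<^sub>\<le>\<^sub>0" for s
  proof -
    have "c - of_nat N - of_nat l \<notin> \<int>\<^sub>\<le>\<^sub>0" if "l < n j" for l
      using Cons.prems(1)[of "l + N"] that unfolding cN N by simp
    from beta_functional_deriv_factor_iter[OF that this] show ?thesis
      unfolding q_def cN by simp
  qed
  show ?case
    unfolding N
  proof (intro exI[of _ q] conjI ballI allI impI)
    show "foldr (\<lambda>j. rodrigues_op (\<alpha> j) (n j)) (j # js) (\<lambda>x. of_real (1 - x) powr c) t =
               of_real (1 - t) powr (c - of_nat (n j + N)) * poly q (of_real t)" 
      if "t \<in> {0<..<1}" for t
      using rodrigues_op_weighted_poly[OF that f, of "\<alpha> j" "n j"] that
      unfolding q_def cN foldr.simps o_apply f_def[symmetric] by simp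
    show "degree q \<le> n j + N"
      unfolding q_def 
      using degree_deriv_factor_iter[of "of_nat (n j) + \<alpha> j" "c - of_nat N" "n j" p] deg by linarith
    have "of_nat (n j) + \<alpha> j - of_nat l \<noteq> 0" if "l < n j" for l
    proof
      assume "of_nat (n j) + \<alpha> j - of_nat l = 0"
      then have "\<alpha> j = - of_nat (n j - l)"
        using that by (simp add: of_nat_diff algebra_simps eq_neg_iff_add_eq_0)
      moreover have "n j - l \<ge> 1" using that by simp
      ultimately have "\<alpha> j \<in> negative_integers" unfolding negative_integers_def by blast
      with Cons.prems(2)[of j] show False by simp
    qed
    then show "poly q 0 \<noteq> 0"
      using p0 by (simp add: q_def poly_0_deriv_factor_iter)
    show "beta_functional (c - of_nat (n j + N)) (\<alpha> i + 1 + of_nat k) q = 0"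
      if i: "i \<in> set (j # js)" and k: "k < n i" for i k
    proof -
      have s: "\<alpha> i + 1 + of_nat k \<notin> \<int>\<^sub>\<le>\<^sub>0"
        using shifted_notin_nonpos_Ints[OF Cons.prems(2)[OF i], of k] by (simp add: add_ac)
      show ?thesis
      proof (cases "i = j")
        case True
        \<comment> \<open>The factor for \<open>s = \<alpha> j + 1 + k\<close> comes from the derivative number \<open>n j - 1 - k\<close>, counted from 0.\<close>
        have "of_nat (n j) + \<alpha> j - of_nat (n j - Suc k) - (\<alpha> i + 1 + of_nat k) = 0"
          using k True by (simp add: of_nat_diff)
        moreover have "n j - Suc k \<in> {..<n j}" using k True by auto
        ultimately have zero: "(\<Prod>l<n j. of_nat (n j) + \<alpha> j - of_nat l - (\<alpha> i + 1 + of_nat k)) = 0"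
          by (intro prod_zero) blast+
        show ?thesis unfolding beta_q[OF s] zero by (rule mult_zero_left)
      next
        case False
        with i k have zero: "beta_functional (c - of_nat N) (\<alpha> i + 1 + of_nat k) p = 0"
          by (intro orth) auto
        show ?thesis unfolding beta_q[OF s] zero by (rule mult_zero_right)
      qed
    qed
  qed
qed

section \<open>Polynomials of small degree are determined by Beta moments\<close>

text \<open>
  What remains of \<open>Beta (s + k) (c + 1)\<close> when the part common to all \<open>k \<le> M\<close> is removed: the rising
  factorials of \<open>s\<close> and of \<open>s + c + 1 + k\<close> with \<open>k\<close> and \<open>M - k\<close> factors.
\<close>
definition beta_numerator :: "complex \<Rightarrow> nat \<Rightarrow> nat \<Rightarrow> complex poly" where
  "beta_numerator c M k = (\<Prod>i<k. [:of_nat i, 1:]) * (\<Prod>i\<in>{k..<M}. [:c + 1 + of_nat i, 1:])"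

lemma poly_beta_numerator:
  "poly (beta_numerator c M k) s = (\<Prod>i<k. s + of_nat i) * (\<Prod>i\<in>{k..<M}. s + c + 1 + of_nat i)"
  by (simp add: beta_numerator_def poly_prod add_ac)

lemma degree_beta_numerator:
  assumes "k \<le> M"
  shows "degree (beta_numerator c M k) \<le> M"
proof -
  have "degree (\<Prod>i<k. [:of_nat i, 1:] :: complex poly) \<le> k"
    using degree_prod_sum_le[of "{..<k}" "\<lambda>i. [:of_nat i, 1:] :: complex poly"] by simp
  moreover have "degree (\<Prod>i\<in>{k..<M}. [:c + 1 + of_nat i, 1:]) \<le> M - k"
    using degree_prod_sum_le[of "{k..<M}" "\<lambda>i. [:c + 1 + of_nat i, 1:]"] by simp
  ultimately show ?thesis
    unfolding beta_numerator_def using assms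
    by (intro order.trans[OF degree_mult_le]) linarith
qed

lemma Beta_eq_beta_numerator:
  assumes "s \<notin> \<int>\<^sub>\<le>\<^sub>0" "k \<le> M"
  shows "Beta (s + of_nat k) (c + 1) =
     Gamma s * Gamma (c + 1) * rGamma (s + c + 1 + of_nat M) * poly (beta_numerator c M k) s"
proof -
  have "rGamma s = pochhammer s k * rGamma (s + of_nat k)"
    by (rule pochhammer_rGamma)
  moreover have "rGamma s \<noteq> 0" using assms(1) by (simp add: rGamma_eq_zero_iff)
  ultimately have 1: "Gamma (s + of_nat k) = Gamma s * pochhammer s k"
    by (auto simp: Gamma_def field_simps)
  have "rGamma (s + of_nat k + (c + 1)) = pochhammer (s + of_nat k + (c + 1)) (M - k) *
      rGamma (s + of_nat k + (c + 1) + of_nat (M - k))"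
    by (rule pochhammer_rGamma)
  also have "s + of_nat k + (c + 1) + of_nat (M - k) = s + c + 1 + of_nat M"
    using assms(2) by (simp add: of_nat_diff)
  also have "pochhammer (s + of_nat k + (c + 1)) (M - k) = (\<Prod>i\<in>{k..<M}. s + c + 1 + of_nat i)"
    unfolding pochhammer_prod using assms(2)
    by (intro prod.reindex_bij_witness[of _ "\<lambda>i. i - k" "\<lambda>i. i + k"]) (auto simp: of_nat_diff)
  finally have 2: "rGamma (s + of_nat k + (c + 1)) =
    (\<Prod>i\<in>{k..<M}. s + c + 1 + of_nat i) * rGamma (s + c + 1 + of_nat M)" .
  show ?thesis
    unfolding Beta_altdef 1 2 poly_beta_numerator
    by (simp add: pochhammer_prod atLeast0LessThan mult_ac)
qed

text \<open>
  At \<open>s = - k\<close> the numerators with a larger index vanish and the numerator of index \<open>k\<close> does not, so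
  the system is triangular.
\<close>
lemma beta_numerator_independent:
  assumes "c \<notin> negative_integers" "(\<Sum>k\<le>M. smult (e k) (beta_numerator c M k)) = 0" "k \<le> M"
  shows "e k = 0"
  using assms(3)
proof (induction k rule: less_induct)
  case (less k)
  have "0 = (\<Sum>i\<le>M. e i * poly (beta_numerator c M i) (- of_nat k))"
    using arg_cong[OF assms(2), of "\<lambda>p. poly p (- of_nat k)"] by (simp add: poly_sum)
  also have "\<dots> = (\<Sum>i\<in>{k}. e i * poly (beta_numerator c M i) (- of_nat k))"
  proof (rule sum.mono_neutral_right)
    show "\<forall>i\<in>{..M} - {k}. e i * poly (beta_numerator c M i) (- of_nat k) = 0"
    proof
      fix i assume i: "i \<in> {..M} - {k}"
      show "e i * poly (beta_numerator c M i) (- of_nat k) = 0"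
      proof (cases "i < k")
        case True
        then show ?thesis using less.IH[of i] i by simp
      next
        case False
        then have "(\<Prod>l<i. - of_nat k + of_nat l :: complex) = 0"
          using i by (intro prod_zero bexI[of _ k]) auto
        then show ?thesis by (simp add: poly_beta_numerator)
      qed
    qed
  qed (use less.prems in auto)
  finally have "e k * poly (beta_numerator c M k) (- of_nat k) = 0" by simp
  moreover have "poly (beta_numerator c M k) (- of_nat k) \<noteq> 0"
  proof -
    have "- of_nat k + c + 1 + of_nat i \<noteq> 0" if "i \<ge> k" for i
    proof -
      have "c + of_nat (Suc (i - k)) \<noteq> 0"
        using shifted_notin_nonpos_Ints[OF assms(1), of "i - k"] by fastforce
      moreover have "c + of_nat (Suc (i - k)) = - of_nat k + c + 1 + of_nat i"
        using that by (simp add: of_nat_diff)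
      ultimately show ?thesis by metis
    qed
    then show ?thesis by (simp add: poly_beta_numerator)
  qed
  ultimately show ?case by simp
qed

text \<open>
  The zeros are zeros of the numerator polynomial, whose degree is at most that of \<open>p\<close>, because the
  Gamma factors in front of it are finite and non-zero at the given points.
\<close>
lemma beta_functional_unisolvent:
  assumes c: "c \<notin> negative_integers"
    and S: "finite S" "S \<inter> \<int>\<^sub>\<le>\<^sub>0 = {}" "\<And>s. s \<in> S \<Longrightarrow> s + c \<notin> negative_integers"
    and deg: "degree p < card S" 
    and zero: "\<And>s. s \<in> S \<Longrightarrow> beta_functional c s p = 0"
  shows "p = 0"
proof -
  define M where "M = degree p"
  define q where "q = (\<Sum>k\<le>M. smult (coeff p k) (beta_numerator c M k))"
  have "poly q s = 0" if s: "s \<in> S" for s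
  proof -
    have s': "s \<notin> \<int>\<^sub>\<le>\<^sub>0" using S(2) s by auto
    have "0 = beta_functional c s p" using zero[OF s] by simp
    also have "\<dots> = Gamma s * Gamma (c + 1) * rGamma (s + c + 1 + of_nat M) * poly q s"
      unfolding beta_functional_def q_def poly_sum sum_distrib_left
      using Beta_eq_beta_numerator[OF s'] by (intro sum.cong) (auto simp: M_def mult_ac)
    finally show ?thesis
      using s' shifted_notin_nonpos_Ints[OF S(3)[OF s], of M] shifted_notin_nonpos_Ints[OF c, of 0]
      by (simp add: Gamma_eq_zero_iff rGamma_eq_zero_iff add_ac)
  qed
  then have roots: "S \<subseteq> {s. poly q s = 0}" by blast
  have "degree q \<le> M"
    unfolding q_def by (intro degree_sum_le) (auto intro: order.trans[OF degree_smult_le] degree_beta_numerator)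
  have "q = 0"
  proof (rule ccontr)
    assume "q \<noteq> 0"
    then have "card S \<le> card {s. poly q s = 0}"
      using card_mono[OF poly_roots_finite roots] by simp
    also have "\<dots> \<le> degree q" by (rule card_poly_roots_bound[OF \<open>q \<noteq> 0\<close>])
    finally show False using deg \<open>degree q \<le> M\<close> by (simp add: M_def)
  qed
  then have "coeff p M = 0"
    using beta_numerator_independent[OF c, where M = M and e = "coeff p" and k = M] by (simp add: q_def)
  then show ?thesis by (simp add: M_def)
qed

section \<open>Perfectness and the Jacobi-Pineiro polynomials\<close>

theorem theorem3p1:
  fixes m :: nat and \<alpha> :: "nat \<Rightarrow> complex" and \<beta> :: complex
  assumes "m \<ge> 1"
    and "\<And>j. j \<in> {1..m} \<Longrightarrow> \<alpha> j \<notin> negative_integers"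
    and "\<beta> \<notin> negative_integers"
    and "\<And>j. j \<in> {1..m} \<Longrightarrow> \<alpha> j + \<beta> \<notin> negative_integers"
    and "\<And>l k. l \<in> {1..m} \<Longrightarrow> k \<in> {1..m} \<Longrightarrow> l \<noteq> k \<Longrightarrow> \<alpha> l - \<alpha> k \<notin> \<int>"
  shows "perfect_system m (\<lambda>j. jacobi_measure (\<alpha> j) \<beta>) \<and>
         (\<forall>n :: nat \<Rightarrow> nat. \<exists>P :: complex poly.
            (\<forall>t\<in>{0<..<1}. poly P (of_real t) = jacobi_pineiro m \<alpha> \<beta> n t) \<and>
            type_II_mop m (\<lambda>j. jacobi_measure (\<alpha> j) \<beta>) n P \<and>
            (\<forall>Q. type_II_mop m (\<lambda>j. jacobi_measure (\<alpha> j) \<beta>) n Q \<longrightarrow>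
                   (\<exists>c. Q = smult c P)))"
proof -
  let ?\<mu> = "\<lambda>j. jacobi_measure (\<alpha> j) \<beta>"
  define orth where "orth n p \<longleftrightarrow> 
     (\<forall>j\<in>{1..m}. \<forall>k<n j. beta_functional \<beta> (\<alpha> j + 1 + of_nat k) p = 0)" for n p
  have type_II_iff: "type_II_mop m ?\<mu> n p \<longleftrightarrow> p \<noteq> 0 \<and> degree p \<le> index_size m n \<and> orth n p" for n p
    using assms(2,3) unfolding type_II_mop_def orth_def
    by (simp add: jacobi_measure_eq_beta_functional beta_functional_monom_mult)
  have orth_lincomb: "orth n (p + smult e q)" if "orth n p" "orth n q" for n p q e
    using that by (simp add: orth_def beta_functional_add beta_functional_smult)
  have normal: "p = 0" if orth: "orth n p" and deg: "degree p < index_size m n" for n p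
  proof -
    \<comment> \<open>The orthogonality relations are conditions at these points of the Mellin transform.\<close>
    define I where "I = (SIGMA j:{1..m}. {..<n j})"
    define node where "node = (\<lambda>(j, k). \<alpha> j + 1 + of_nat k)"
    have "inj_on node I"
    proof (rule inj_onI, clarify)
      fix j k j' k' assume I: "(j, k) \<in> I" "(j', k') \<in> I" and eq: "node (j, k) = node (j', k')"
      then have diff: "\<alpha> j - \<alpha> j' = of_nat k' - of_nat k"
        by (simp add: node_def algebra_simps)
      then have "\<alpha> j - \<alpha> j' \<in> \<int>" by simp
      then have "j = j'" using assms(5)[of j j'] I by (auto simp: I_def)
      with diff show "j = j' \<and> k = k'" by simp
    qed
    then have card: "card (node ` I) = index_size m n"
      by (simp add: card_image I_def index_size_def)
    have node_eq: "node (j, k) = \<alpha> j + of_nat (Suc k)" 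
       "node (j, k) + \<beta> = (\<alpha> j + \<beta>) + of_nat (Suc k)" for j k
      by (simp_all add: node_def)
    show "p = 0"
    proof (rule beta_functional_unisolvent[OF assms(3), where S = "node ` I"])
      show "finite (node ` I)" by (simp add: I_def)
      show "node ` I \<inter> \<int>\<^sub>\<le>\<^sub>0 = {}"
        using shifted_notin_nonpos_Ints[OF assms(2)] unfolding I_def by (auto simp only: node_eq)
      show "s + \<beta> \<notin> negative_integers" if "s \<in> node ` I" for s
      proof -
        obtain j k where "j \<in> {1..m}" "s = node (j, k)"
          using \<open>s \<in> node ` I\<close> by (auto simp: I_def)
        then have "s + \<beta> = (\<alpha> j + \<beta>) + of_nat (Suc k)"
          using node_eq(2) by metis
        with shifted_notin_negative_integers[OF assms(4)[OF \<open>j \<in> {1..m}\<close>]] show ?thesis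
          by metis
      qed
      show "beta_functional \<beta> s p = 0" if "s \<in> node ` I" for s
        using that orth by (auto simp: I_def node_def orth_def)
    qed (use card deg in simp)
  qed
  have perfect: "perfect_system m ?\<mu>"
    unfolding perfect_system_def normal_index_def
  proof (intro allI impI)
    fix n p assume "type_II_mop m ?\<mu> n p"
    then have "p \<noteq> 0" "degree p \<le> index_size m n" "orth n p" by (simp_all add: type_II_iff)
    with normal[of n p] show "degree p = index_size m n" by linarith
  qed
  have "\<exists>P. (\<forall>t\<in>{0<..<1}. poly P (of_real t) = jacobi_pineiro m \<alpha> \<beta> n t) \<and>
            type_II_mop m ?\<mu> n P \<and> (\<forall>Q. type_II_mop m ?\<mu> n Q \<longrightarrow> (\<exists>c. Q = smult c P))" for n
  proof -
    define N where "N = index_size m n"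
    have set: "set [1..<Suc m] = {1..m}" by auto
    have size: "(\<Sum>j\<leftarrow>[1..<Suc m]. n j) = N"
      unfolding interv_sum_list_conv_sum_set_nat set N_def index_size_def ..
    define f where "f = foldr (\<lambda>j. rodrigues_op (\<alpha> j) (n j)) [1..<Suc m] 
       (\<lambda>x. of_real (1 - x) powr (of_nat N + \<beta>))"
    have "\<exists>p. (\<forall>t\<in>{0<..<1}. f t = of_real (1 - t) powr (of_nat N + \<beta> - of_nat N) * poly p (of_real t)) \<and>
           degree p \<le> N \<and> poly p 0 \<noteq> 0 \<and>
           (\<forall>j\<in>{1..m}. \<forall>k<n j. beta_functional (of_nat N + \<beta> - of_nat N) (\<alpha> j + 1 + of_nat k) p = 0)"
      unfolding f_def size[symmetric] set[symmetric]
    proof (rule rodrigues_product_weighted_poly, unfold size set)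
      fix l assume l: "l < N"
      have "of_nat N + \<beta> - of_nat l = \<beta> + of_nat (Suc (N - Suc l))"
        using l by (simp add: of_nat_diff)
      then show "of_nat N + \<beta> - of_nat l \<notin> \<int>\<^sub>\<le>\<^sub>0"
        using shifted_notin_nonpos_Ints[OF assms(3), of "N - Suc l"] by metis
    qed (rule assms(2))
    then obtain p where p: "\<And>t. t \<in> {0<..<1} \<Longrightarrow> f t = of_real (1 - t) powr \<beta> * poly p (of_real t)"
      "degree p \<le> N" "poly p 0 \<noteq> 0" "orth n p"
      unfolding orth_def by auto
    define C where "C = 1 / (\<Prod>j\<in>{1..m}. fact (n j) :: complex)"
    have "C \<noteq> 0" by (simp add: C_def)
    define P where "P = smult C p"
    have "poly P (of_real t) = jacobi_pineiro m \<alpha> \<beta> n t" if t: "t \<in> {0<..<1}" for t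
    proof -
      have "jacobi_pineiro m \<alpha> \<beta> n t = 
          C * of_real (1 - t) powr (- \<beta>) * (of_real (1 - t) powr \<beta> * poly p (of_real t))"
        unfolding p(1)[OF t, symmetric] f_def jacobi_pineiro_def C_def N_def ..
      also have "\<dots> = C * (of_real (1 - t) powr (- \<beta>) * of_real (1 - t) powr \<beta>) * poly p (of_real t)"
        by (simp only: mult.assoc)
      also have "of_real (1 - t) powr (- \<beta>) * of_real (1 - t) powr \<beta> = (1 :: complex)"
        using t by (simp flip: powr_add)
      finally show ?thesis by (simp add: P_def)
    qed
    moreover have P: "type_II_mop m ?\<mu> n P"
      using p \<open>C \<noteq> 0\<close> unfolding type_II_iff P_def N_def[symmetric]
      by (auto simp: orth_def beta_functional_smult)
    moreover have "\<exists>c. Q = smult c P" if Q: "type_II_mop m ?\<mu> n Q" for Q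
    proof -
      have deg: "degree Q = N" "degree P = N"
        using perfect P Q unfolding perfect_system_def normal_index_def N_def by blast+
      have "P \<noteq> 0" using P by (simp add: type_II_iff)
      \<comment> \<open>The leading terms cancel, so \<open>R\<close> still satisfies the relations but has too small a degree.\<close>
      define R where "R = Q + smult (- (lead_coeff Q / lead_coeff P)) P"
      have "orth n R"
        unfolding R_def by (rule orth_lincomb) (use P Q in \<open>simp_all add: type_II_iff\<close>)
      have "coeff R N = 0"
        unfolding R_def deg using leading_coeff_neq_0[OF \<open>P \<noteq> 0\<close>, unfolded deg] by simp
      moreover have "degree R \<le> N"
        unfolding R_def using deg by (intro degree_add_le order.trans[OF degree_smult_le]) auto
      ultimately have "R = 0 \<or> degree R < N"
        by (metis leading_coeff_0_iff le_neq_implies_less)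
      then have "R = 0" using normal[OF \<open>orth n R\<close>] by (auto simp: N_def)
      then have "Q = smult (lead_coeff Q / lead_coeff P) P" by (simp add: R_def)
      then show ?thesis ..
    qed
    ultimately show ?thesis by blast
  qed
  with perfect show ?thesis by blast
qed

end
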